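(* Let $1\le i\le d-1$, $q>0$, $p\in[0,1]$, and let $\mathbb{F}$ be a field. The balanced plaquette random-cluster model on $\mathbb{T}^d_N$ satisfies $$\tilde\mu_{\mathbb{T}^d_N,p,q,i}(P)\overset{d}{=}\tilde\mu_{\mathbb{T}^d_N,p^*,q,d-i}(P^\bullet),$$ that is, if $P$ is distributed as the balanced $i$-dimensional plaquette random-cluster model with parameters $p,q$, then its dual complex $P^\bullet$ is distributed as the balanced $(d-i)$-dimensional plaquette random-cluster model with parameters $p^*,q$ (on the dual complex $(\mathbb{T}^d_N)^\bullet\cong\mathbb{T}^d_N$), where $$p^*=\frac{(1-p)q}{(1-p)q+p}.$$
   Context: $\mathbb{T}^d_N$ is the $d$-dimensional torus with the cubical complex structure obtained by dividing $[0,N]^d$ into unit cubes and identifying opposite faces of $[0,N]^d$. Its dual complex $(\mathbb{T}^d_N)^\bullet$ is obtained by shifting by $1/2$ in each coordinate direction; each $j$-plaquette of $\mathbb{T}^d_N$ intersects exactly one $(d-j)$-plaquette of $(\mathbb{T}^d_N)^\bullet$, its dual plaquette. For a subcomplex $P\subset\mathbb{T}^d_N$, the dual complex $P^\bullet$ is the union of all plaquettes of $(\mathbb{T}^d_N)^\bullet$ whose dual plaquette is not included in $P$. The balanced $i$-dimensional plaquette random-cluster model is the probability measure on $i$-dimensional subcomplexes $P$ of $\mathbb{T}^d_N$ containing the full $(i-1)$-skeleton given by $$\tilde\mu_{\mathbb{T}^d_N,p,q,i}(P)=\frac{(\sqrt q)^{-b_i(P)}}{\tilde Z}\,p^{\eta(P)}(1-p)^{|F^i_N|-\eta(P)}q^{\mathbf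 b_{i-1}(P)},$$ where $\eta(P)$ is the number of $i$-cells of $P$, $|F^i_N|$ is the number of $i$-cells of $\mathbb{T}^d_N$, $\mathbf b_{i-1}(P)=\dim H_{i-1}(P;\mathbb{F})$, $b_i(P)$ is the rank of the map $H_i(P;\mathbb{F})\to H_i(\mathbb{T}^d_N;\mathbb{F})$ induced by inclusion, and $\tilde Z$ is a normalizing constant. *)

theory Defs
  imports
    "HOL-Probability.Probability"
    "HOL-Library.Real_Mod"
    "HOL-Algebra.AbelCoset"
    "Jordan_Normal_Form.VS_Connect"
begin

section \<open>Cells of the cubical torus and of its dual complex\<close>

text \<open>
  The torus is \<open>(\<real> / N\<int>)\<^sup>d\<close>, its points being represented by functions in
  \<open>{..<d} \<rightarrow>\<^sub>E {0..<N}\<close>. A pair \<open>(x, S)\<close> denotes the closed cube with base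
  vertex \<open>x\<close> that extends by one unit in each direction in \<open>S\<close> (modulo \<open>N\<close>); it has
  dimension \<open>card S\<close>. The parameter \<open>s\<close> shifts the whole complex by \<open>s\<close> in each
  coordinate direction: \<open>s = 0\<close> gives the torus itself and \<open>s = 1/2\<close> its dual complex.
\<close>

type_synonym cell = "(nat \<Rightarrow> real) \<times> nat set"

definition torus_cells :: "nat \<Rightarrow> nat \<Rightarrow> real \<Rightarrow> cell set" where
  "torus_cells d N s = ({..<d} \<rightarrow>\<^sub>E (\<lambda>a. s + real a) ` {..<N}) \<times> Pow {..<d}"

definition cell_dim :: "cell \<Rightarrow> nat" where
  "cell_dim \<sigma> = card (snd \<sigma>)"

definition cell_points :: "nat \<Rightarrow> nat \<Rightarrow> cell \<Rightarrow> (nat \<Rightarrow> real) set" where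
  "cell_points d N \<sigma> = {y \<in> {..<d} \<rightarrow>\<^sub>E {0..<real N}.
     \<forall>k<d. \<exists>t \<in> (if k \<in> snd \<sigma> then {0..1} else {0}). y k = (fst \<sigma> k + t) rmod real N}"

definition lower_face :: "cell \<Rightarrow> nat \<Rightarrow> cell" where
  "lower_face \<sigma> k = (fst \<sigma>, snd \<sigma> - {k})"

definition upper_face :: "nat \<Rightarrow> cell \<Rightarrow> nat \<Rightarrow> cell" where
  "upper_face N \<sigma> k = ((fst \<sigma>)(k := (fst \<sigma> k + 1) rmod real N), snd \<sigma> - {k})"

definition subcomplex :: "nat \<Rightarrow> nat \<Rightarrow> real \<Rightarrow> cell set \<Rightarrow> bool" where
  "subcomplex d N s P \<longleftrightarrow> P \<subseteq> torus_cells d N s \<and>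
     (\<forall>\<sigma>\<in>P. \<forall>k\<in>snd \<sigma>. lower_face \<sigma> k \<in> P \<and> upper_face N \<sigma> k \<in> P)"

definition dual_plaquettes :: "nat \<Rightarrow> nat \<Rightarrow> cell \<Rightarrow> cell \<Rightarrow> bool" where
  "dual_plaquettes d N \<sigma> \<tau> \<longleftrightarrow> \<sigma> \<in> torus_cells d N 0 \<and> \<tau> \<in> torus_cells d N (1/2) \<and>
     cell_dim \<sigma> + cell_dim \<tau> = d \<and> cell_points d N \<sigma> \<inter> cell_points d N \<tau> \<noteq> {}"

definition dual_complex :: "nat \<Rightarrow> nat \<Rightarrow> cell set \<Rightarrow> cell set" where
  "dual_complex d N P = {\<tau>. \<exists>\<sigma>. dual_plaquettes d N \<sigma> \<tau> \<and> \<sigma> \<notin> P}"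


section \<open>Cellular homology with coefficients in a field\<close>

definition chain_module :: "cell set \<Rightarrow> nat \<Rightarrow> ('f::field, cell \<Rightarrow> 'f) module" where
  "chain_module P j =
     \<lparr>carrier = {c. \<forall>\<sigma>. c \<sigma> \<noteq> 0 \<longrightarrow> \<sigma> \<in> P \<and> cell_dim \<sigma> = j},
      mult = undefined, one = undefined,
      zero = (\<lambda>_. 0), add = (\<lambda>c c' \<sigma>. c \<sigma> + c' \<sigma>), smult = (\<lambda>a c \<sigma>. a * c \<sigma>)\<rparr>"

text \<open>
  For \<open>N = 1\<close> the two opposite faces of a cube coincide in the torus, which is why
  incidence numbers are defined as sums over directions.
\<close>

definition incidence :: "nat \<Rightarrow> cell \<Rightarrow> cell \<Rightarrow> 'f::field" where
  "incidence N \<sigma> \<tau> = (\<Sum>k\<in>snd \<sigma>. (-1) ^ card {l \<in> snd \<sigma>. l < k} *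
     (of_bool (\<tau> = upper_face N \<sigma> k) - of_bool (\<tau> = lower_face \<sigma> k)))"

definition boundary :: "nat \<Rightarrow> (cell \<Rightarrow> 'f::field) \<Rightarrow> cell \<Rightarrow> 'f" where
  "boundary N c \<tau> = (\<Sum>\<sigma> | c \<sigma> \<noteq> 0. c \<sigma> * incidence N \<sigma> \<tau>)"

definition cycles :: "nat \<Rightarrow> cell set \<Rightarrow> nat \<Rightarrow> (cell \<Rightarrow> 'f::field) set" where
  "cycles N P j = {c \<in> carrier (chain_module P j). boundary N c = (\<lambda>_. 0)}"

definition boundaries :: "nat \<Rightarrow> cell set \<Rightarrow> nat \<Rightarrow> (cell \<Rightarrow> 'f::field) set" where
  "boundaries N P j = boundary N ` carrier (chain_module P (Suc j))"

definition FactModule :: "('a, 'b) module \<Rightarrow> 'b set \<Rightarrow> ('a, 'b set) module" where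
  "FactModule M W =
     \<lparr>carrier = a_rcosets\<^bsub>M\<^esub> W, mult = undefined, one = undefined,
      zero = W, add = set_add M, smult = (\<lambda>a A. \<Union>x\<in>A. W +>\<^bsub>M\<^esub> (a \<odot>\<^bsub>M\<^esub> x))\<rparr>"

definition homology :: "nat \<Rightarrow> cell set \<Rightarrow> nat \<Rightarrow> ('f::field, (cell \<Rightarrow> 'f) set) module" where
  "homology N P j = FactModule (chain_module P j\<lparr>carrier := cycles N P j\<rparr>) (boundaries N P j)"

definition betti :: "'f::field itself \<Rightarrow> nat \<Rightarrow> cell set \<Rightarrow> nat \<Rightarrow> nat" where
  "betti _ N P j = vectorspace.dim class_ring (homology N P j :: ('f, _) module)"

text \<open>The map on homology induced by an inclusion \<open>P \<subseteq> Q\<close>: the class of \<open>z\<close> in \<open>P\<close> is sent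
  to the class of \<open>z\<close> in \<open>Q\<close>.\<close>

definition induced_map ::
    "nat \<Rightarrow> cell set \<Rightarrow> nat \<Rightarrow> (cell \<Rightarrow> 'f::field) set \<Rightarrow> (cell \<Rightarrow> 'f) set" where
  "induced_map N Q j A = (\<Union>z\<in>A. boundaries N Q j +>\<^bsub>chain_module Q j\<^esub> z)"

definition induced_rank :: "'f::field itself \<Rightarrow> nat \<Rightarrow> cell set \<Rightarrow> cell set \<Rightarrow> nat \<Rightarrow> nat" where
  "induced_rank _ N P Q j = vectorspace.dim class_ring
     ((homology N Q j :: ('f, _) module)
        \<lparr>carrier := induced_map N Q j ` carrier (homology N P j :: ('f, _) module)\<rparr>)"


section \<open>The balanced plaquette random-cluster model\<close>

definition plaquette_configs :: "nat \<Rightarrow> nat \<Rightarrow> real \<Rightarrow> nat \<Rightarrow> cell set set" where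
  "plaquette_configs d N s i = {P. subcomplex d N s P \<and> (\<forall>\<sigma>\<in>P. cell_dim \<sigma> \<le> i) \<and>
     (\<forall>\<sigma>\<in>torus_cells d N s. cell_dim \<sigma> < i \<longrightarrow> \<sigma> \<in> P)}"

definition num_cells :: "nat \<Rightarrow> cell set \<Rightarrow> nat" where
  "num_cells i P = card {\<sigma>\<in>P. cell_dim \<sigma> = i}"

definition balanced_weight ::
    "'f::field itself \<Rightarrow> nat \<Rightarrow> nat \<Rightarrow> real \<Rightarrow> real \<Rightarrow> real \<Rightarrow> nat \<Rightarrow> cell set \<Rightarrow> real" where
  "balanced_weight F d N s p q i P =
     sqrt q powi (- int (induced_rank F N P (torus_cells d N s) i)) *
     p ^ num_cells i P * (1 - p) ^ (num_cells i (torus_cells d N s) - num_cells i P) *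
     q ^ betti F N P (i - 1)"

definition balanced_Z ::
    "'f::field itself \<Rightarrow> nat \<Rightarrow> nat \<Rightarrow> real \<Rightarrow> real \<Rightarrow> real \<Rightarrow> nat \<Rightarrow> real" where
  "balanced_Z F d N s p q i = (\<Sum>P\<in>plaquette_configs d N s i. balanced_weight F d N s p q i P)"

definition balanced_PRCM ::
    "'f::field itself \<Rightarrow> nat \<Rightarrow> nat \<Rightarrow> real \<Rightarrow> real \<Rightarrow> real \<Rightarrow> nat \<Rightarrow> cell set measure" where
  "balanced_PRCM F d N s p q i = point_measure (plaquette_configs d N s i)
     (\<lambda>P. ennreal (balanced_weight F d N s p q i P / balanced_Z F d N s p q i))"


section \<open>Well-definedness\<close>

lemma finite_torus_cells: "finite (torus_cells d N s)"
  unfolding torus_cells_def by (intro finite_cartesian_product finite_PiE) auto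

lemma finite_plaquette_configs: "finite (plaquette_configs d N s i)"
  by (rule finite_subset[of _ "Pow (torus_cells d N s)"])
    (auto simp: plaquette_configs_def subcomplex_def finite_torus_cells)

lemma upper_face_in_torus_cells:
  assumes "0 \<le> s" "s < 1" "\<sigma> \<in> torus_cells d N s" "k \<in> snd \<sigma>"
  shows "upper_face N \<sigma> k \<in> torus_cells d N s"
proof -
  from assms have k: "k < d" by (auto simp: torus_cells_def)
  with assms obtain a where a: "a < N" "fst \<sigma> k = s + real a"
    by (fastforce simp: torus_cells_def PiE_iff)
  have "(s + real a + 1) rmod real N \<in> (\<lambda>a. s + real a) ` {..<N}"
  proof (cases "Suc a < N")
    case True
    have "(s + real a + 1) rmod real N = s + real (Suc a)"
      by (rule rmod_unique[where n = 0]) (use assms True in auto)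
    with True show ?thesis by (auto intro!: image_eqI)
  next
    case False
    with a have N: "N = Suc a" by simp
    have "(s + real a + 1) rmod real N = s"
      by (rule rmod_unique[where n = 1]) (use assms N in auto)
    with N show ?thesis by (auto intro!: image_eqI[where x = 0])
  qed
  with assms(3) k a(2) show ?thesis
    by (auto simp: torus_cells_def upper_face_def PiE_iff extensional_def)
qed

lemma skeleton_in_plaquette_configs:
  assumes "0 \<le> s" "s < 1" "A \<subseteq> {\<sigma>\<in>torus_cells d N s. cell_dim \<sigma> = i}"
  shows "{\<sigma>\<in>torus_cells d N s. cell_dim \<sigma> < i} \<union> A \<in> plaquette_configs d N s i"
proof -
  have fin: "finite (snd \<sigma>)" if "\<sigma> \<in> torus_cells d N s" for \<sigma>
    using that unfolding torus_cells_def mem_Times_iff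
    by (metis Pow_iff finite_lessThan finite_subset)
  have lower: "lower_face \<sigma> k \<in> torus_cells d N s" if "\<sigma> \<in> torus_cells d N s" for \<sigma> k
    using that unfolding torus_cells_def lower_face_def mem_Times_iff by auto
  have dim: "cell_dim (lower_face \<sigma> k) < cell_dim \<sigma>" "cell_dim (upper_face N \<sigma> k) < cell_dim \<sigma>"
    if "\<sigma> \<in> torus_cells d N s" "k \<in> snd \<sigma>" for \<sigma> k
    unfolding cell_dim_def lower_face_def upper_face_def snd_conv
    using fin[OF that(1)] that(2) by (rule card_Diff1_less)+
  show ?thesis
    unfolding plaquette_configs_def subcomplex_def
    using assms(3) lower dim upper_face_in_torus_cells[OF assms(1,2)] by fastforce
qed

lemma balanced_weight_nonneg:
  assumes "q > 0" "0 \<le> p" "p \<le> 1"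
  shows "balanced_weight F d N s p q i P \<ge> 0"
  using assms by (simp add: balanced_weight_def)

lemma balanced_Z_pos:
  assumes "q > 0" "0 \<le> p" "p \<le> 1" "0 \<le> s" "s < 1"
  shows "balanced_Z F d N s p q i > 0"
proof -
  define P where "P = {\<sigma>\<in>torus_cells d N s. cell_dim \<sigma> < i} \<union>
    (if p = 0 then {} else {\<sigma>\<in>torus_cells d N s. cell_dim \<sigma> = i})"
  have P: "P \<in> plaquette_configs d N s i"
    unfolding P_def by (rule skeleton_in_plaquette_configs) (use assms in auto)
  have "num_cells i P = (if p = 0 then 0 else num_cells i (torus_cells d N s))"
    unfolding num_cells_def P_def by (auto intro!: arg_cong[where f = card] simp: card_eq_0_iff)
  hence "balanced_weight F d N s p q i P > 0"
    using assms by (simp add: balanced_weight_def)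
  thus ?thesis
    unfolding balanced_Z_def
    using P assms by (intro sum_pos2[OF finite_plaquette_configs P] balanced_weight_nonneg)
qed

lemma prob_space_balanced_PRCM:
  assumes "q > 0" "0 \<le> p" "p \<le> 1" "0 \<le> s" "s < 1"
  shows "prob_space (balanced_PRCM F d N s p q i)"
proof -
  let ?w = "balanced_weight F d N s p q i" and ?Z = "balanced_Z F d N s p q i"
  have Z: "?Z > 0" by (rule balanced_Z_pos) (use assms in auto)
  have w: "?w P \<ge> 0" for P by (rule balanced_weight_nonneg) (use assms in auto)
  have "(\<Sum>P\<in>plaquette_configs d N s i. ennreal (?w P / ?Z)) =
        ennreal ((\<Sum>P\<in>plaquette_configs d N s i. ?w P) / ?Z)"
    using Z w by (subst sum_ennreal) (auto simp: sum_divide_distrib)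
  also have "\<dots> = 1" using Z by (simp flip: balanced_Z_def)
  finally show ?thesis
    unfolding balanced_PRCM_def
    by (intro prob_space_point_measure finite_plaquette_configs) auto
qed

end

theory Submission
  imports Defs
begin

text \<open>Let \<open>T\<close> be the torus, \<open>T'\<close> its dual complex, and for a configuration \<open>P\<close> let \<open>A\<close> be the set of its
  \<open>i\<close>-cells. Chains are functions on cells; write \<open>F\<^sup>A\<close> for those supported on \<open>A\<close> and \<open>B\<^sub>i\<close> for the
  space of \<open>i\<close>-boundaries of \<open>T\<close>. As \<open>P\<close> contains the full \<open>(i - 1)\<close>-skeleton and nothing above
  dimension \<open>i\<close>, its homology enters the weight only through the two numbers
  \<open>r = dim \<partial>(F\<^sup>A)\<close> and \<open>g = dim (F\<^sup>A \<inter> B\<^sub>i)\<close>: by rank-nullity the Betti number in degree \<open>i - 1\<close> is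
  \<open>z - r\<close> with \<open>z\<close> independent of \<open>P\<close>, and the rank of \<open>H\<^sub>i(P) \<rightarrow> H\<^sub>i(T)\<close> is \<open>card A - r - g\<close>
  (lemma \<open>config_ranks\<close>).

  The \<open>(d - i)\<close>-cells of the dual complex of \<open>P\<close> are the duals of the \<open>i\<close>-cells outside \<open>A\<close>. Up to a
  sign attached to each cell, the boundary matrix of \<open>T'\<close> is the transpose of that of \<open>T\<close>
  (lemma \<open>incidence_dual\<close>). Hence the dual number \<open>r'\<close> is the row rank of the matrix of
  \<open>\<partial>\<^sub>i\<^sub>+\<^sub>1\<close> restricted to the rows outside \<open>A\<close>. The column space of this restricted matrix is the image
  of \<open>B\<^sub>i\<close> under the projection that forgets \<open>A\<close>, and the kernel of that projection on \<open>B\<^sub>i\<close> is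
  \<open>F\<^sup>A \<inter> B\<^sub>i\<close>. Since row rank equals column rank, \<open>r' + g = dim B\<^sub>i\<close>, a constant; exchanging the roles
  of \<open>T\<close> and \<open>T'\<close> shows that \<open>r + g'\<close> is constant as well (lemma \<open>rank_duality\<close>).

  In terms of \<open>sqrt q\<close>, the homological part of the weight of \<open>P\<close> has exponent
  \<open>2 (z - r) - (card A - r - g) = 2 z - card A - r + g\<close>. Replacing \<open>r\<close>, \<open>g\<close>, \<open>card A\<close> by their dual
  values changes this, up to a constant, only by \<open>- 2 m\<close>, where \<open>m\<close> is the number of \<open>i\<close>-cells
  outside \<open>A\<close> (lemma \<open>betti_duality\<close>). These \<open>m\<close> powers of \<open>q\<close> are what \<open>pstar\<close> supplies: by
  definition the odds \<open>pstar : (1 - pstar)\<close> are \<open>q (1 - p) : p\<close>, and \<open>pstar\<close> occurs to the power \<open>m\<close>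
  in the dual weight. So dual configurations have proportional weights with a common factor, and normalisation
  makes the two probabilities equal.\<close>

section \<open>Dimension of spaces of functions\<close>

text \<open>Every space of chains, cycles or boundaries below is a set of functions with pointwise
  operations, so it is determined by its carrier; this record turns the carrier into a module.\<close>
definition fun_space :: "('x \<Rightarrow> 'f::field) set \<Rightarrow> ('f, 'x \<Rightarrow> 'f) module" where
  "fun_space U = \<lparr>carrier = U, mult = undefined, one = undefined, zero = (\<lambda>_. 0),
     add = (\<lambda>c c' x. c x + c' x), smult = (\<lambda>a c x. a * c x)\<rparr>"

definition lin_closed :: "('x \<Rightarrow> 'f::field) set \<Rightarrow> bool" where
  "lin_closed U \<longleftrightarrow> (\<lambda>_. 0) \<in> U \<and> (\<forall>u\<in>U. \<forall>v\<in>U. (\<lambda>x. u x + v x) \<in> U) \<and>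
     (\<forall>a. \<forall>u\<in>U. (\<lambda>x. a * u x) \<in> U)"

definition supported_on :: "'x set \<Rightarrow> ('x \<Rightarrow> 'f::field) set" where
  "supported_on A = {c. \<forall>x. x \<notin> A \<longrightarrow> c x = 0}"

definition fun_dim :: "('x \<Rightarrow> 'f::field) set \<Rightarrow> nat" where
  "fun_dim U = vectorspace.dim class_ring (fun_space U)"

definition linear_on :: "('x \<Rightarrow> 'f::field) set \<Rightarrow> (('x \<Rightarrow> 'f) \<Rightarrow> ('y \<Rightarrow> 'f)) \<Rightarrow> bool" where
  "linear_on U f \<longleftrightarrow> (\<forall>u\<in>U. \<forall>v\<in>U. f (\<lambda>x. u x + v x) = (\<lambda>y. f u y + f v y)) \<and>
     (\<forall>a. \<forall>u\<in>U. f (\<lambda>x. a * u x) = (\<lambda>y. a * f u y))"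

lemma fun_space_simps [simp]:
  "carrier (fun_space U) = U" "zero (fun_space U) = (\<lambda>_. 0)"
  "add (fun_space U) = (\<lambda>c c' x. c x + c' x)" "smult (fun_space U) = (\<lambda>a c x. a * c x)"
  "fun_space U\<lparr>carrier := W\<rparr> = fun_space W"
  by (auto simp: fun_space_def)

lemma lin_closed_supported_on: "lin_closed (supported_on A)"
  by (simp add: lin_closed_def supported_on_def)

lemma lin_closed_UNIV: "lin_closed UNIV"
  by (simp add: lin_closed_def)

lemma lin_closed_diff: "lin_closed W \<Longrightarrow> u \<in> W \<Longrightarrow> v \<in> W \<Longrightarrow> (\<lambda>x. u x - v x) \<in> W"
proof -
  assume W: "lin_closed W" and uv: "u \<in> W" "v \<in> W"
  then have "(\<lambda>x. (-1) * v x) \<in> W" unfolding lin_closed_def by blast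
  with W uv(1) have "(\<lambda>x. u x + (\<lambda>x. (-1) * v x) x) \<in> W" unfolding lin_closed_def by meson
  then show ?thesis by simp
qed

lemma lin_closed_add: "lin_closed W \<Longrightarrow> u \<in> W \<Longrightarrow> v \<in> W \<Longrightarrow> (\<lambda>x. u x + v x) \<in> W"
  by (simp add: lin_closed_def)

lemma lin_closed_smult: "lin_closed W \<Longrightarrow> u \<in> W \<Longrightarrow> (\<lambda>x. a * u x) \<in> W"
  by (simp add: lin_closed_def)

lemma lin_closed_0: "lin_closed W \<Longrightarrow> (\<lambda>_. 0) \<in> W"
  by (simp add: lin_closed_def)

lemma supported_on_mono: "A \<subseteq> B \<Longrightarrow> supported_on A \<subseteq> supported_on B"
  by (auto simp: supported_on_def)

lemma linear_on_zero: "lin_closed U \<Longrightarrow> linear_on U f \<Longrightarrow> f (\<lambda>_. 0) = (\<lambda>_. 0)"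
proof -
  assume "lin_closed U" "linear_on U f"
  then have "(\<lambda>_. 0) \<in> U" and f: "\<forall>a. \<forall>u\<in>U. f (\<lambda>x. a * u x) = (\<lambda>y. a * f u y)"
    by (simp_all add: lin_closed_def linear_on_def)
  from bspec[OF spec[OF f, of 0] this(1)] show ?thesis by simp
qed

lemma lin_closed_image:
  assumes "lin_closed U" "linear_on U f"
  shows "lin_closed (f ` U)"
  unfolding lin_closed_def
proof (intro conjI ballI allI)
  show "(\<lambda>_. 0) \<in> f ` U"
    using linear_on_zero[OF assms] assms(1) unfolding lin_closed_def by (metis imageI)
next
  fix u v assume "u \<in> f ` U" "v \<in> f ` U"
  then obtain u' v' where "u' \<in> U" "v' \<in> U" "u = f u'" "v = f v'" by blast
  then show "(\<lambda>x. u x + v x) \<in> f ` U"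
    using assms unfolding lin_closed_def linear_on_def
    by (intro image_eqI[where x = "\<lambda>x. u' x + v' x"]) auto
next
  fix a u assume "u \<in> f ` U"
  then obtain u' where "u' \<in> U" "u = f u'" by blast
  then show "(\<lambda>x. a * u x) \<in> f ` U"
    using assms unfolding lin_closed_def linear_on_def
    by (intro image_eqI[where x = "\<lambda>x. a * u' x"]) auto
qed

lemma lin_closed_kernel:
  assumes "lin_closed U" "linear_on U f"
  shows "lin_closed {u \<in> U. f u = (\<lambda>_. 0)}"
  unfolding lin_closed_def
proof (intro conjI ballI allI)
  show "(\<lambda>_. 0) \<in> {u \<in> U. f u = (\<lambda>_. 0)}"
    using linear_on_zero[OF assms] assms(1) by (simp add: lin_closed_def)
next
  fix u v assume uv: "u \<in> {u \<in> U. f u = (\<lambda>_. 0)}" "v \<in> {u \<in> U. f u = (\<lambda>_. 0)}"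
  then have "(\<lambda>x. u x + v x) \<in> U" using assms(1) unfolding lin_closed_def by blast
  moreover have "f (\<lambda>x. u x + v x) = (\<lambda>y. f u y + f v y)"
    using uv assms(2) unfolding linear_on_def by blast
  ultimately show "(\<lambda>x. u x + v x) \<in> {u \<in> U. f u = (\<lambda>_. 0)}" using uv by simp
next
  fix a u assume u: "u \<in> {u \<in> U. f u = (\<lambda>_. 0)}"
  then have "(\<lambda>x. a * u x) \<in> U" using assms(1) unfolding lin_closed_def by blast
  moreover have "f (\<lambda>x. a * u x) = (\<lambda>y. a * f u y)"
    using u assms(2) unfolding linear_on_def by blast
  ultimately show "(\<lambda>x. a * u x) \<in> {u \<in> U. f u = (\<lambda>_. 0)}" using u by simp
qed

lemma vectorspace_fun_space:
  assumes "lin_closed U"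
  shows "vectorspace class_ring (fun_space U)"
proof (rule vs_criteria[OF class_field])
  show "\<forall>v\<in>carrier (fun_space U). \<exists>w\<in>carrier (fun_space U). v \<oplus>\<^bsub>fun_space U\<^esub> w = \<zero>\<^bsub>fun_space U\<^esub>"
  proof
    fix v assume "v \<in> carrier (fun_space U)"
    then have "(\<lambda>x. (-1) * v x) \<in> U"
      using assms unfolding lin_closed_def fun_space_simps by blast
    then show "\<exists>w\<in>carrier (fun_space U). v \<oplus>\<^bsub>fun_space U\<^esub> w = \<zero>\<^bsub>fun_space U\<^esub>"
      by (intro bexI[where x = "\<lambda>x. -1 * v x"]) auto
  qed
qed (use assms in \<open>auto simp: lin_closed_def algebra_simps\<close>)

lemma linear_map_fun_space:
  fixes f :: "('x \<Rightarrow> 'f::field) \<Rightarrow> ('y \<Rightarrow> 'f)"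
  assumes "lin_closed U" "linear_on U f"
  shows "linear_map class_ring (fun_space U) (fun_space UNIV) f"
proof -
  interpret U: vectorspace class_ring "fun_space U" by (rule vectorspace_fun_space) fact
  interpret V: vectorspace class_ring "fun_space (UNIV :: ('y \<Rightarrow> 'f) set)"
    by (rule vectorspace_fun_space) (rule lin_closed_UNIV)
  show ?thesis
    by unfold_locales (use assms(2) in \<open>auto simp: module_hom_def linear_on_def\<close>)
qed

lemma submodule_fun_space:
  assumes "lin_closed U" "lin_closed W" "W \<subseteq> U"
  shows "submodule class_ring W (fun_space U)"
proof -
  interpret U: vectorspace class_ring "fun_space U" by (rule vectorspace_fun_space) fact
  show ?thesis
    by unfold_locales (use assms(2,3) in \<open>auto simp: lin_closed_def\<close>)
qed

text \<open>Closure under the operations is included so that one predicate carries all that the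
  rank-nullity theorem requires of its domain.\<close>
definition fun_fin_dim :: "('x \<Rightarrow> 'f::field) set \<Rightarrow> bool" where
  "fun_fin_dim U \<longleftrightarrow> lin_closed U \<and> vectorspace.fin_dim class_ring (fun_space U)"

lemma fun_fin_dim_lin_closed: "fun_fin_dim U \<Longrightarrow> lin_closed U"
  by (simp add: fun_fin_dim_def)

text \<open>Independence in a subspace is independence in the whole space, which bounds the size of
  independent subsets; a maximal one is then a basis.\<close>
lemma fun_fin_dim_subspace:
  assumes "fun_fin_dim U" "lin_closed W" "W \<subseteq> U"
  shows "fun_fin_dim W" and "fun_dim W \<le> fun_dim U"
proof -
  have U: "lin_closed U" using assms(1) by (simp add: fun_fin_dim_def)
  interpret U: vectorspace class_ring "fun_space U" by (rule vectorspace_fun_space) fact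
  interpret W: vectorspace class_ring "fun_space W" by (rule vectorspace_fun_space) fact
  have fd: "U.fin_dim" using assms(1) by (simp add: fun_fin_dim_def)
  have sub: "submodule class_ring W (fun_space U)"
    using submodule_fun_space[OF U assms(2,3)] .
  have small: "finite S \<and> card S \<le> U.dim" if "S \<subseteq> W \<and> W.lin_indpt S" for S
  proof -
    have "U.lin_indpt S"
      using U.span_li_not_depend(2)[OF _ sub, of S] that by simp
    then show ?thesis using U.li_le_dim[OF fd, of S] that assms(3) by auto
  qed
  have "W.lin_indpt {}" unfolding W.lin_dep_def by blast
  then have "\<exists>S. finite S \<and> maximal S (\<lambda>S. S \<subseteq> carrier (fun_space W) \<and> W.lin_indpt S)"
    using small by (intro maximal_exists[where N = U.dim and B = "{}"]) simp_all
  then obtain S where S: "finite S" "maximal S (\<lambda>S. S \<subseteq> carrier (fun_space W) \<and> W.lin_indpt S)"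
    by blast
  then have b: "W.basis S" by (intro W.max_li_is_basis)
  then have "W.fin_dim" using S(1) by (auto simp: W.fin_dim_def W.basis_def)
  then show "fun_fin_dim W" using assms(2) by (simp add: fun_fin_dim_def)
  have "W.dim = card S" using b S(1) by (rule W.dim_basis[rotated])
  then show "fun_dim W \<le> fun_dim U"
    using small[of S] b by (simp add: fun_dim_def W.basis_def)
qed

lemma fun_rank_nullity:
  assumes "fun_fin_dim U" "linear_on U f"
  shows "fun_dim (f ` U) + fun_dim {u \<in> U. f u = (\<lambda>_. 0)} = fun_dim U"
proof -
  have U: "lin_closed U" using assms(1) by (simp add: fun_fin_dim_def)
  interpret f: linear_map class_ring "fun_space U" "fun_space UNIV" f
    by (rule linear_map_fun_space) fact+
  have "f.V.fin_dim" using assms(1) by (simp add: fun_fin_dim_def)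
  from f.rank_nullity[OF this] show ?thesis
    by (simp add: fun_dim_def f.im_def f.ker_def)
qed

lemma fun_dim_zero [simp]: "fun_dim {\<lambda>_. 0 :: 'f::field} = 0"
proof -
  have z: "lin_closed {\<lambda>_. 0 :: 'f}" by (simp add: lin_closed_def)
  interpret Z: vectorspace class_ring "fun_space {\<lambda>_. 0 :: 'f}"
    by (rule vectorspace_fun_space) (rule z)
  show ?thesis unfolding fun_dim_def using Z.gen_ge_dim[of "{}"] Z.span_empty by simp
qed

lemma fun_dim_inj_image:
  assumes "fun_fin_dim U" "linear_on U f" "\<And>u. u \<in> U \<Longrightarrow> f u = (\<lambda>_. 0) \<Longrightarrow> u = (\<lambda>_. 0)"
  shows "fun_dim (f ` U) = fun_dim U"
proof -
  have "{u \<in> U. f u = (\<lambda>_. 0)} = {\<lambda>_. 0}"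
    using assms linear_on_zero[of U f] by (auto simp: fun_fin_dim_def lin_closed_def)
  then show ?thesis using fun_rank_nullity[OF assms(1,2)] by simp
qed

text \<open>An enumeration of \<open>A\<close> identifies the functions supported on \<open>A\<close> with vectors of length
  \<open>card A\<close>.\<close>
lemma supported_on_dim:
  fixes A :: "'x set"
  assumes "finite A"
  shows fun_fin_dim_supported_on: "fun_fin_dim (supported_on A :: ('x \<Rightarrow> 'f::field) set)"
    and fun_dim_supported_on: "fun_dim (supported_on A :: ('x \<Rightarrow> 'f::field) set) = card A"
proof -
  let ?U = "supported_on A :: ('x \<Rightarrow> 'f) set"
  obtain h where h: "bij_betw h A {..<card A}"
    using assms by (metis bij_betw_iff_card card_lessThan finite_lessThan)
  define T where "T = (\<lambda>v :: 'f vec. \<lambda>x. if x \<in> A then vec_index v (h x) else 0)"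
  have hA: "h x < card A" if "x \<in> A" for x using h that by (auto simp: bij_betw_def)
  interpret V: vec_space "TYPE('f)" "card A" .
  interpret T: linear_map class_ring "module_vec TYPE('f) (card A)" "fun_space ?U" T
  proof (unfold linear_map_def mod_hom_def mod_hom_axioms_def, intro conjI)
    show U: "vectorspace class_ring (fun_space ?U)"
      by (rule vectorspace_fun_space[OF lin_closed_supported_on])
    then show "Module.module class_ring (fun_space ?U)" by (rule vectorspace.axioms)
    show "T \<in> module_hom class_ring (module_vec TYPE('f) (card A)) (fun_space ?U)"
      using hA by (auto simp: module_hom_def T_def supported_on_def module_vec_def)
  qed unfold_locales
  have inj: "inj_on T (carrier (module_vec TYPE('f) (card A)))"
  proof (rule inj_onI)
    fix v w :: "'f vec"
    assume vw: "v \<in> carrier (module_vec TYPE('f) (card A))"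
      "w \<in> carrier (module_vec TYPE('f) (card A))" "T v = T w"
    show "v = w"
    proof (rule eq_vecI)
      fix i assume "i < dim_vec w"
      then obtain x where x: "x \<in> A" "h x = i"
        using h vw(2) by (metis (no_types, lifting) bij_betw_iff_bijections carrier_vecD lessThan_iff module_vec_simps(3))
      then show "vec_index v i = vec_index w i" using fun_cong[OF vw(3), of x] by (simp add: T_def)
    qed (use vw(1,2) in \<open>simp add: module_vec_def\<close>)
  qed
  have surj: "T ` carrier (module_vec TYPE('f) (card A)) = carrier (fun_space ?U)"
  proof (intro equalityI subsetI)
    fix c assume c: "c \<in> carrier (fun_space ?U)"
    have "the_inv_into A h (h x) = x" if "x \<in> A" for x
      using h that by (simp add: bij_betw_def the_inv_into_f_f)
    then have "c = T (vec (card A) (\<lambda>i. c (the_inv_into A h i)))"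
      using c hA by (auto simp: T_def supported_on_def fun_eq_iff)
    then show "c \<in> T ` carrier (module_vec TYPE('f) (card A))"
      by (rule image_eqI) (simp add: module_vec_def)
  next
    fix c assume "c \<in> T ` carrier (module_vec TYPE('f) (card A))"
    then show "c \<in> carrier (fun_space ?U)" using T.f_im by blast
  qed
  show "fun_fin_dim ?U"
    unfolding fun_fin_dim_def using T.surj_fin_dim[OF V.fin_dim surj] lin_closed_supported_on by blast
  show "fun_dim ?U = card A"
    unfolding fun_dim_def using T.dim_eq[OF V.fin_dim inj surj] V.dim_is_n by simp
qed

section \<open>Rank of matrices indexed by arbitrary finite sets\<close>

lemma lincomb_fun_space:
  assumes "lin_closed U" "finite S" "S \<subseteq> U"
  shows "LinearCombinations.module.lincomb (fun_space U) a S = (\<lambda>x. \<Sum>b\<in>S. a b * b x)"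
proof -
  interpret U: vectorspace class_ring "fun_space U" by (rule vectorspace_fun_space) fact
  show ?thesis
    using assms(2,3)
  proof (induction S)
    case empty
    then show ?case by (simp add: U.lincomb_def)
  next
    case (insert b S)
    have "U.lincomb a (insert b S) = U.lincomb a (S \<union> {b})" by simp
    also have "\<dots> = a b \<odot>\<^bsub>fun_space U\<^esub> b \<oplus>\<^bsub>fun_space U\<^esub> U.lincomb a S"
      by (rule U.lincomb_insert) (use insert in auto)
    finally show ?case using insert by simp
  qed
qed

text \<open>The only consequence of having a basis that the rank computations use: coordinates with
  respect to \<open>dim U\<close> many functions.\<close>
lemma fun_space_basis:
  assumes "fun_fin_dim U"
  obtains S where "finite S" "card S = fun_dim U"
    "\<And>u. u \<in> U \<Longrightarrow> \<exists>a. u = (\<lambda>x. \<Sum>b\<in>S. a b * b x)"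
proof -
  have U: "lin_closed U" using assms by (simp add: fun_fin_dim_def)
  interpret U: vectorspace class_ring "fun_space U" by (rule vectorspace_fun_space) fact
  have "U.fin_dim" using assms by (simp add: fun_fin_dim_def)
  then obtain S where S: "finite S" "U.basis S" using U.finite_basis_exists by blast
  have sub: "S \<subseteq> U" and gen: "U.span S = U" using S(2) by (auto simp: U.basis_def)
  have "\<exists>a. u = (\<lambda>x. \<Sum>b\<in>S. a b * b x)" if "u \<in> U" for u
    using U.finite_in_span[OF S(1), of u] sub gen that lincomb_fun_space[OF U S(1) sub]
    by (metis fun_space_simps(1))
  moreover have "card S = fun_dim U"
    unfolding fun_dim_def using U.dim_basis[OF S] by simp
  ultimately show ?thesis using that S(1) by blast
qed

text \<open>Multiplication by the submatrix of \<open>m\<close> with rows \<open>A\<close> and columns \<open>B\<close>.\<close>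
definition mat_map :: "('x \<Rightarrow> 'y \<Rightarrow> 'f::field) \<Rightarrow> 'x set \<Rightarrow> 'y set \<Rightarrow> ('y \<Rightarrow> 'f) \<Rightarrow> 'x \<Rightarrow> 'f" where
  "mat_map m A B c = (\<lambda>x. if x \<in> A then \<Sum>y\<in>B. m x y * c y else 0)"

lemma linear_on_mat_map: "linear_on U (mat_map m A B)"
  by (simp add: linear_on_def mat_map_def fun_eq_iff sum.distrib sum_distrib_left distrib_left
      mult.left_commute)

lemma fun_fin_dim_image:
  assumes "finite A" "lin_closed U" "linear_on U f" "f ` U \<subseteq> supported_on A"
  shows "fun_fin_dim (f ` U)"
  using fun_fin_dim_subspace(1)[OF fun_fin_dim_supported_on[OF assms(1)] lin_closed_image[OF assms(2,3)] assms(4)] .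

lemma mat_map_image_supported: "mat_map m A B ` U \<subseteq> supported_on A"
  by (simp add: image_subset_iff mat_map_def supported_on_def)

lemma fun_fin_dim_mat_map:
  assumes "finite A"
  shows "fun_fin_dim (mat_map m A B ` supported_on B)"
  by (rule fun_fin_dim_image[OF assms lin_closed_supported_on linear_on_mat_map mat_map_image_supported])

text \<open>If the rows of \<open>m\<close> are combinations of the elements of a finite set \<open>S\<close>, then \<open>m\<close> factors
  through the functions on \<open>S\<close>, so its column space has dimension at most \<open>card S\<close>. Apply this to
  a basis \<open>S\<close> of the row space.\<close>
lemma rank_le_rank_transpose:
  fixes m :: "'x \<Rightarrow> 'y \<Rightarrow> 'f::field"
  assumes A: "finite A" and B: "finite B"
  shows "fun_dim (mat_map m A B ` supported_on B)
       \<le> fun_dim (mat_map (\<lambda>y x. m x y) B A ` supported_on A)"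
proof -
  let ?R = "mat_map (\<lambda>y x. m x y) B A ` supported_on A"
  obtain S where S: "finite S" "card S = fun_dim ?R"
    "\<And>u. u \<in> ?R \<Longrightarrow> \<exists>a. u = (\<lambda>y. \<Sum>b\<in>S. a b * b y)"
    by (rule fun_space_basis[OF fun_fin_dim_mat_map[OF B, of "\<lambda>y x. m x y" A]]) blast
  have "\<exists>a. \<forall>y\<in>B. m x y = (\<Sum>b\<in>S. a b * b y)" if "x \<in> A" for x
  proof -
    \<comment> \<open>The image of a unit vector under the transpose is a row of \<open>m\<close>.\<close>
    let ?r = "mat_map (\<lambda>y x. m x y) B A (\<lambda>z. if z = x then 1 else 0)"
    have "?r \<in> ?R" using that by (intro imageI) (auto simp: supported_on_def)
    from S(3)[OF this] obtain a where a: "?r = (\<lambda>y. \<Sum>b\<in>S. a b * b y)" by blast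
    have "?r y = m x y" if "y \<in> B" for y
      using that \<open>x \<in> A\<close> A by (simp add: mat_map_def if_distrib cong: if_cong)
    then have "\<forall>y\<in>B. m x y = (\<Sum>b\<in>S. a b * b y)" using fun_cong[OF a] by simp
    then show ?thesis by (intro exI[where x = a])
  qed
  then have "\<forall>x\<in>A. \<exists>a. \<forall>y\<in>B. m x y = (\<Sum>b\<in>S. a b * b y)" by (rule ballI)
  from bchoice[OF this] obtain a
    where a: "\<And>x y. x \<in> A \<Longrightarrow> y \<in> B \<Longrightarrow> m x y = (\<Sum>b\<in>S. a x b * b y)"
    by blast
  have "mat_map m A B c = mat_map a A S (\<lambda>b. if b \<in> S then \<Sum>y\<in>B. b y * c y else 0)" for c
  proof
    fix x
    have "(\<Sum>y\<in>B. (\<Sum>b\<in>S. a x b * b y) * c y) = (\<Sum>b\<in>S. a x b * (\<Sum>y\<in>B. b y * c y))"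
      unfolding sum_distrib_left sum_distrib_right
      by (subst sum.swap) (simp add: mult.assoc)
    then show "mat_map m A B c x = mat_map a A S (\<lambda>b. if b \<in> S then \<Sum>y\<in>B. b y * c y else 0) x"
      using a by (simp add: mat_map_def cong: sum.cong)
  qed
  then have sub: "mat_map m A B ` supported_on B \<subseteq> mat_map a A S ` supported_on S"
    by (auto simp: supported_on_def)
  have "fun_dim (mat_map m A B ` supported_on B) \<le> fun_dim (mat_map a A S ` supported_on S)"
    by (rule fun_fin_dim_subspace(2)[OF fun_fin_dim_mat_map[OF A] fun_fin_dim_lin_closed sub])
       (rule fun_fin_dim_mat_map[OF A])
  also have "\<dots> \<le> fun_dim (supported_on S :: (('y \<Rightarrow> 'f) \<Rightarrow> 'f) set)"
    using fun_rank_nullity[OF fun_fin_dim_supported_on[OF S(1)] linear_on_mat_map[of _ a A S]] by linarith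
  also have "\<dots> = fun_dim ?R" using fun_dim_supported_on[OF S(1)] S(2) by simp
  finally show ?thesis .
qed

lemma row_rank_eq_column_rank:
  assumes "finite A" "finite B"
  shows "fun_dim (mat_map m A B ` supported_on B)
       = fun_dim (mat_map (\<lambda>y x. m x y) B A ` supported_on A)"
  using rank_le_rank_transpose[OF assms, of m]
    rank_le_rank_transpose[OF assms(2,1), of "\<lambda>y x. m x y"] by simp

text \<open>Forgetting the values outside \<open>B\<close> maps the column space \<open>V\<close> of \<open>m\<close> onto the column space of the
  submatrix with rows \<open>B\<close>, and the kernel consists of the elements of \<open>V\<close> supported on \<open>X - B\<close>. The rank of
  the submatrix can be computed from its transpose.\<close>
lemma complementary_rank:
  assumes X: "finite X" and Y: "finite Y" and B: "B \<subseteq> X"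
  shows "fun_dim (mat_map m X Y ` supported_on Y)
       = fun_dim (mat_map m X Y ` supported_on Y \<inter> supported_on (X - B))
       + fun_dim (mat_map (\<lambda>y x. m x y) Y B ` supported_on B)"
proof -
  let ?V = "mat_map m X Y ` supported_on Y"
  define \<rho> where "\<rho> = (\<lambda>c :: 'a \<Rightarrow> 'c. \<lambda>x. if x \<in> B then c x else 0)"
  have lin: "linear_on ?V \<rho>" by (auto simp: linear_on_def \<rho>_def fun_eq_iff)
  have "\<rho> (mat_map m X Y c) = mat_map m B Y c" for c
    using B by (auto simp: \<rho>_def mat_map_def fun_eq_iff)
  then have im: "\<rho> ` ?V = mat_map m B Y ` supported_on Y" by (simp add: image_image)
  have "{u \<in> ?V. \<rho> u = (\<lambda>_. 0)} = ?V \<inter> supported_on (X - B)"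
    using mat_map_image_supported[of m X Y]
    by (auto simp: \<rho>_def supported_on_def fun_eq_iff)
  then have "fun_dim (mat_map m B Y ` supported_on Y) + fun_dim (?V \<inter> supported_on (X - B)) = fun_dim ?V"
    using fun_rank_nullity[OF fun_fin_dim_mat_map[OF X] lin] im by simp
  then show ?thesis
    using row_rank_eq_column_rank[OF finite_subset[OF B X] Y, of m] by simp
qed

text \<open>Renaming rows and columns and scaling them by nonzero factors preserves the rank. For dual
  cells the factors will be signs.\<close>
lemma mat_map_reindex:
  fixes m :: "'y \<Rightarrow> 'x \<Rightarrow> 'f::field" and m' :: "'z \<Rightarrow> 'z \<Rightarrow> 'f" and h :: "'y \<Rightarrow> 'z" and h' :: "'x \<Rightarrow> 'z"
  assumes Y: "finite Y" "inj_on h Y" and B: "inj_on h' B"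
    and m': "\<And>x y. x \<in> B \<Longrightarrow> y \<in> Y \<Longrightarrow> m' (h y) (h' x) = e y * e' x * m y x"
    and e: "\<And>y. y \<in> Y \<Longrightarrow> e y \<noteq> 0" "\<And>x. x \<in> B \<Longrightarrow> e' x \<noteq> 0"
  shows "fun_dim (mat_map m' (h ` Y) (h' ` B) ` supported_on (h' ` B))
       = fun_dim (mat_map m Y B ` supported_on B)"
proof -
  define \<Phi> where "\<Phi> c = (\<lambda>z. if z \<in> h ` Y then e (the_inv_into Y h z) * c (the_inv_into Y h z) else 0)"
    for c :: "'y \<Rightarrow> 'f"
  define \<Psi> where "\<Psi> c = (\<lambda>x. if x \<in> B then e' x * c (h' x) else 0)" for c :: "'z \<Rightarrow> 'f"
  have \<Phi>: "\<Phi> c (h y) = e y * c y" if "y \<in> Y" for c y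
    using that Y(2) by (simp add: \<Phi>_def the_inv_into_f_f)
  have comm: "mat_map m' (h ` Y) (h' ` B) c = \<Phi> (mat_map m Y B (\<Psi> c))" for c
  proof
    fix z
    show "mat_map m' (h ` Y) (h' ` B) c z = \<Phi> (mat_map m Y B (\<Psi> c)) z"
    proof (cases "z \<in> h ` Y")
      case True
      then obtain y where y: "y \<in> Y" "z = h y" by blast
      have "(\<Sum>x\<in>h' ` B. m' (h y) x * c x) = (\<Sum>x\<in>B. m' (h y) (h' x) * c (h' x))"
        by (simp add: sum.reindex[OF B])
      also have "\<dots> = (\<Sum>x\<in>B. e y * (m y x * \<Psi> c x))"
        by (rule sum.cong) (auto simp: m' y(1) \<Psi>_def)
      finally show ?thesis
        using y by (simp add: \<Phi> mat_map_def sum_distrib_left)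
    qed (simp add: mat_map_def \<Phi>_def)
  qed
  have "\<Psi> ` supported_on (h' ` B) = supported_on B"
  proof (intro equalityI subsetI)
    fix c :: "'x \<Rightarrow> 'f" assume c: "c \<in> supported_on B"
    let ?c = "\<lambda>z. if z \<in> h' ` B then c (the_inv_into B h' z) / e' (the_inv_into B h' z) else 0"
    have "c = \<Psi> ?c"
      using c e(2) B by (auto simp: \<Psi>_def supported_on_def fun_eq_iff the_inv_into_f_f)
    moreover have "?c \<in> supported_on (h' ` B)" by (simp add: supported_on_def)
    ultimately show "c \<in> \<Psi> ` supported_on (h' ` B)" by blast
  qed (auto simp: \<Psi>_def supported_on_def)
  then have im: "mat_map m' (h ` Y) (h' ` B) ` supported_on (h' ` B)
      = \<Phi> ` (mat_map m Y B ` supported_on B)"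
    by (metis (no_types, lifting) comm image_cong image_image)
  have lin: "linear_on U \<Phi>" for U
    by (simp add: linear_on_def \<Phi>_def fun_eq_iff distrib_left mult.left_commute)
  have "u = (\<lambda>_. 0)" if u: "u \<in> mat_map m Y B ` supported_on B" "\<Phi> u = (\<lambda>_. 0)" for u
  proof
    fix y
    show "u y = 0"
    proof (cases "y \<in> Y")
      case True
      then show ?thesis using \<Phi>[OF True, of u] u(2) e(1) by simp
    next
      case False
      then show ?thesis using u(1) by (auto simp: mat_map_def)
    qed
  qed
  then show ?thesis
    unfolding im by (rule fun_dim_inj_image[OF fun_fin_dim_mat_map[OF Y(1)] lin])
qed

section \<open>Dimension of quotients\<close>

lemma coset_fun_space: "W +>\<^bsub>fun_space U\<^esub> z = {c. \<exists>w\<in>W. c = (\<lambda>x. w x + z x)}"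
  by (auto simp: a_r_coset_def r_coset_def)

lemma mem_coset_iff:
  assumes "lin_closed W"
  shows "c \<in> W +>\<^bsub>fun_space U\<^esub> z \<longleftrightarrow> (\<lambda>x. c x - z x) \<in> W"
proof
  assume "(\<lambda>x. c x - z x) \<in> W"
  then show "c \<in> W +>\<^bsub>fun_space U\<^esub> z"
    unfolding coset_fun_space by (intro CollectI bexI[where x = "\<lambda>x. c x - z x"]) auto
qed (auto simp: coset_fun_space)

lemma coset_eq_iff:
  assumes W: "lin_closed W"
  shows "W +>\<^bsub>fun_space U\<^esub> z = W +>\<^bsub>fun_space U\<^esub> z' \<longleftrightarrow> (\<lambda>x. z x - z' x) \<in> W"
proof
  assume "W +>\<^bsub>fun_space U\<^esub> z = W +>\<^bsub>fun_space U\<^esub> z'"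
  moreover have "z \<in> W +>\<^bsub>fun_space U\<^esub> z"
    using lin_closed_0[OF W] by (simp add: mem_coset_iff[OF W])
  ultimately show "(\<lambda>x. z x - z' x) \<in> W" by (simp add: mem_coset_iff[OF W])
next
  assume d: "(\<lambda>x. z x - z' x) \<in> W"
  have "(\<lambda>x. c x - z x) \<in> W \<longleftrightarrow> (\<lambda>x. c x - z' x) \<in> W" for c
    using lin_closed_add[OF W, of "\<lambda>x. c x - z x" "\<lambda>x. z x - z' x"] d
      lin_closed_diff[OF W, of "\<lambda>x. c x - z' x" "\<lambda>x. z x - z' x"] by auto
  then show "W +>\<^bsub>fun_space U\<^esub> z = W +>\<^bsub>fun_space U\<^esub> z'"
    by (auto simp: mem_coset_iff[OF W])
qed

lemma coset_zero:
  assumes "lin_closed W"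
  shows "W +>\<^bsub>fun_space U\<^esub> (\<lambda>_. 0) = W"
  by (auto simp: mem_coset_iff[OF assms])

lemma coset_add:
  assumes W: "lin_closed W"
  shows "(W +>\<^bsub>fun_space U\<^esub> z) <+>\<^bsub>fun_space U\<^esub> (W +>\<^bsub>fun_space U\<^esub> z')
       = W +>\<^bsub>fun_space U\<^esub> (\<lambda>x. z x + z' x)"
proof (intro equalityI subsetI)
  fix c assume "c \<in> (W +>\<^bsub>fun_space U\<^esub> z) <+>\<^bsub>fun_space U\<^esub> (W +>\<^bsub>fun_space U\<^esub> z')"
  then obtain v v' where v: "(\<lambda>x. v x - z x) \<in> W" "(\<lambda>x. v' x - z' x) \<in> W" "c = (\<lambda>x. v x + v' x)"
    by (auto simp: set_add_def set_mult_def mem_coset_iff[OF W])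
  from lin_closed_add[OF W v(1,2)] show "c \<in> W +>\<^bsub>fun_space U\<^esub> (\<lambda>x. z x + z' x)"
    by (simp add: mem_coset_iff[OF W] v(3) algebra_simps)
next
  fix c assume c: "c \<in> W +>\<^bsub>fun_space U\<^esub> (\<lambda>x. z x + z' x)"
  have "(\<lambda>x. c x - z' x) \<in> W +>\<^bsub>fun_space U\<^esub> z" "z' \<in> W +>\<^bsub>fun_space U\<^esub> z'"
    using c lin_closed_0[OF W] by (simp_all add: mem_coset_iff[OF W] algebra_simps)
  moreover have "c = (\<lambda>x. (c x - z' x) + z' x)" by simp
  ultimately show "c \<in> (W +>\<^bsub>fun_space U\<^esub> z) <+>\<^bsub>fun_space U\<^esub> (W +>\<^bsub>fun_space U\<^esub> z')"
    unfolding set_add_def set_mult_def by force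
qed

text \<open>The scalar multiplication of the quotient module unites the cosets of all multiples; they
  coincide.\<close>
lemma coset_smult:
  assumes W: "lin_closed W"
  shows "(\<Union>x\<in>W +>\<^bsub>fun_space U\<^esub> z. W +>\<^bsub>fun_space U'\<^esub> (\<lambda>y. a * x y))
       = W +>\<^bsub>fun_space U\<^esub> (\<lambda>y. a * z y)"
proof -
  have "W +>\<^bsub>fun_space U'\<^esub> (\<lambda>y. a * x y) = W +>\<^bsub>fun_space U\<^esub> (\<lambda>y. a * z y)"
    if "x \<in> W +>\<^bsub>fun_space U\<^esub> z" for x
  proof -
    have "(\<lambda>y. a * (x y - z y)) \<in> W"
      using lin_closed_smult[OF W] that by (simp add: mem_coset_iff[OF W])
    then have "W +>\<^bsub>fun_space U\<^esub> (\<lambda>y. a * x y) = W +>\<^bsub>fun_space U\<^esub> (\<lambda>y. a * z y)"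
      by (simp add: coset_eq_iff[OF W] right_diff_distrib)
    then show ?thesis by (simp add: coset_fun_space)
  qed
  moreover have "z \<in> W +>\<^bsub>fun_space U\<^esub> z"
    using lin_closed_0[OF W] by (simp add: mem_coset_iff[OF W])
  ultimately show ?thesis by blast
qed

lemma FactModule_fun_space:
  "carrier (FactModule (fun_space U) W) = (\<lambda>u. W +>\<^bsub>fun_space U\<^esub> u) ` U"
  "zero (FactModule (fun_space U) W) = W"
  by (auto simp: FactModule_def A_RCOSETS_def RCOSETS_def a_r_coset_def)

lemma FactModule_ops:
  assumes "lin_closed W"
  shows "(W +>\<^bsub>fun_space U\<^esub> z) \<oplus>\<^bsub>FactModule (fun_space U) W\<^esub> (W +>\<^bsub>fun_space U\<^esub> z')
      = W +>\<^bsub>fun_space U\<^esub> (\<lambda>x. z x + z' x)"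
    and "a \<odot>\<^bsub>FactModule (fun_space U) W\<^esub> (W +>\<^bsub>fun_space U\<^esub> z) = W +>\<^bsub>fun_space U\<^esub> (\<lambda>x. a * z x)"
  using coset_add[OF assms] coset_smult[OF assms] by (simp_all add: FactModule_def)

lemma vectorspace_FactModule:
  assumes U: "lin_closed U" and W: "lin_closed W"
  shows "vectorspace class_ring (FactModule (fun_space U) W)"
proof -
  let ?Q = "FactModule (fun_space U) W" and ?cos = "\<lambda>z. W +>\<^bsub>fun_space U\<^esub> z"
  note ops = FactModule_ops[OF W]
  have zero: "\<zero>\<^bsub>?Q\<^esub> = ?cos (\<lambda>_. 0)"
    by (simp add: FactModule_fun_space coset_zero[OF W])
  have neg: "\<exists>w\<in>?cos ` U. ?cos u \<oplus>\<^bsub>?Q\<^esub> w = ?cos (\<lambda>_. 0)" if "u \<in> U" for u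
  proof
    show "?cos u \<oplus>\<^bsub>?Q\<^esub> ?cos (\<lambda>x. (-1) * u x) = ?cos (\<lambda>_. 0)" by (simp add: ops)
    show "?cos (\<lambda>x. (-1) * u x) \<in> ?cos ` U" using lin_closed_smult[OF U that] by blast
  qed
  show ?thesis
    by (rule vs_criteria[OF class_field])
       (use lin_closed_0[OF U] lin_closed_add[OF U] lin_closed_smult[OF U] neg in
         \<open>auto simp: FactModule_fun_space(1) zero ops algebra_simps\<close>)
qed

text \<open>Rank-nullity for the projection onto the quotient, restricted to \<open>Z\<close>. For \<open>Z = U\<close> this is the
  dimension of the quotient; for smaller \<open>Z\<close> it is the rank of a map induced by inclusion.\<close>
lemma dim_coset_image:
  assumes U: "lin_closed U" and W: "lin_closed W" and Z: "fun_fin_dim Z" "Z \<subseteq> U"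
  shows "vectorspace.dim class_ring
           (FactModule (fun_space U) W\<lparr>carrier := (\<lambda>z. W +>\<^bsub>fun_space U\<^esub> z) ` Z\<rparr>)
         + fun_dim (Z \<inter> W) = fun_dim Z"
proof -
  let ?Q = "FactModule (fun_space U) W" and ?f = "\<lambda>z. W +>\<^bsub>fun_space U\<^esub> z"
  have "lin_closed Z" using Z(1) by (rule fun_fin_dim_lin_closed)
  then have Zv: "vectorspace class_ring (fun_space Z)" by (rule vectorspace_fun_space)
  have Qv: "vectorspace class_ring ?Q" by (rule vectorspace_FactModule[OF U W])
  interpret f: linear_map class_ring "fun_space Z" ?Q ?f
  proof (unfold linear_map_def mod_hom_def mod_hom_axioms_def, intro conjI)
    show "Module.module class_ring (fun_space Z)" "Module.module class_ring ?Q"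
      using Zv Qv by (simp_all add: vectorspace_def)
    show "?f \<in> module_hom class_ring (fun_space Z) ?Q"
      using Z(2) by (auto simp: module_hom_def FactModule_fun_space FactModule_ops[OF W])
  qed (rule Zv Qv)+
  have ker: "f.ker = Z \<inter> W"
    using coset_zero[OF W, of U] coset_eq_iff[OF W, of U _ "\<lambda>_. 0"]
    by (auto simp: f.ker_def FactModule_fun_space)
  have "f.V.fin_dim" using Z(1) by (simp add: fun_fin_dim_def)
  from f.rank_nullity[OF this] show ?thesis
    by (simp add: fun_dim_def f.im_def ker)
qed

section \<open>The cellular boundary map\<close>

definition orientation_sign :: "nat set \<Rightarrow> nat \<Rightarrow> 'f::field" where
  "orientation_sign S k = (-1) ^ card {l \<in> S. l < k}"

lemma incidence_alt:
  "incidence N \<sigma> \<tau> = (\<Sum>k\<in>snd \<sigma>. orientation_sign (snd \<sigma>) k *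
     (of_bool (\<tau> = upper_face N \<sigma> k) - of_bool (\<tau> = lower_face \<sigma> k)))"
  by (simp add: incidence_def orientation_sign_def)

lemma orientation_sign_swap_less:
  assumes "finite S" "k \<in> S" "k < l"
  shows "orientation_sign S k * orientation_sign (S - {k}) l
       = - (orientation_sign S l * orientation_sign (S - {l}) k :: 'f::field)"
proof -
  have "{m \<in> S. m < l} = insert k {m \<in> S - {k}. m < l}" using assms(2,3) by auto
  then have "card {m \<in> S. m < l} = Suc (card {m \<in> S - {k}. m < l})" using assms(1) by simp
  moreover have "{m \<in> S - {l}. m < k} = {m \<in> S. m < k}" using assms(3) by auto
  ultimately show ?thesis by (simp add: orientation_sign_def mult.commute)
qed

text \<open>Removing two directions in either order gives opposite signs, since only the removal of the
  smaller one changes the position of the other.\<close>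
lemma orientation_sign_swap:
  assumes "finite S" "k \<in> S" "l \<in> S" "k \<noteq> l"
  shows "orientation_sign S k * orientation_sign (S - {k}) l
       = - (orientation_sign S l * orientation_sign (S - {l}) k :: 'f::field)"
proof (cases "k < l")
  case True
  then show ?thesis by (rule orientation_sign_swap_less[OF assms(1,2)])
next
  case False
  then have "l < k" using assms(4) by simp
  then show ?thesis using orientation_sign_swap_less[OF assms(1,3), of k, where ?'f = 'f] by simp
qed

text \<open>Pairing the terms \<open>(k, l)\<close> and \<open>(l, k)\<close> keeps the argument valid in characteristic 2, where
  a sum that equals its own negative need not vanish.\<close>
lemma sum_antisym_eq_0:
  fixes g :: "'x \<Rightarrow> 'x \<Rightarrow> 'f::field"
  assumes "finite S" "\<And>k l. k \<in> S \<Longrightarrow> l \<in> S \<Longrightarrow> k \<noteq> l \<Longrightarrow> g k l = - g l k"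
  shows "(\<Sum>k\<in>S. \<Sum>l\<in>S - {k}. g k l) = 0"
  using assms
proof (induction S)
  case (insert a S)
  have "(\<Sum>l\<in>insert a S - {k}. g k l) = g k a + (\<Sum>l\<in>S - {k}. g k l)" if "k \<in> S" for k
  proof -
    have "insert a S - {k} = insert a (S - {k})" using insert(2) that by auto
    then show ?thesis using insert(1,2) by simp
  qed
  moreover have "insert a S - {a} = S" using insert(2) by auto
  ultimately have "(\<Sum>k\<in>insert a S. \<Sum>l\<in>insert a S - {k}. g k l)
      = (\<Sum>l\<in>S. g a l) + (\<Sum>k\<in>S. g k a + (\<Sum>l\<in>S - {k}. g k l))"
    using insert(1,2) by simp
  also have "\<dots> = (\<Sum>l\<in>S. g a l + g l a) + (\<Sum>k\<in>S. \<Sum>l\<in>S - {k}. g k l)"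
    by (simp add: sum.distrib)
  also have "(\<Sum>l\<in>S. g a l + g l a) = 0"
    using insert(2,4) by (intro sum.neutral ballI) (metis insertCI neg_eq_iff_add_eq_0)
  also have "(\<Sum>k\<in>S. \<Sum>l\<in>S - {k}. g k l) = 0"
    by (rule insert(3)) (use insert(4) in blast)
  finally show ?case by simp
qed simp

lemma face_commute:
  assumes "k \<noteq> l"
  shows "upper_face N (upper_face N \<sigma> k) l = upper_face N (upper_face N \<sigma> l) k"
    "upper_face N (lower_face \<sigma> k) l = lower_face (upper_face N \<sigma> l) k"
    "lower_face (lower_face \<sigma> k) l = lower_face (lower_face \<sigma> l) k"
  using assms by (auto simp: upper_face_def lower_face_def fun_upd_twist)

lemma sum_incidence:
  assumes "finite X" "finite (snd \<sigma>)"
    "\<And>k. k \<in> snd \<sigma> \<Longrightarrow> upper_face N \<sigma> k \<in> X" "\<And>k. k \<in> snd \<sigma> \<Longrightarrow> lower_face \<sigma> k \<in> X"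
  shows "(\<Sum>\<tau>\<in>X. incidence N \<sigma> \<tau> * f \<tau>) = (\<Sum>k\<in>snd \<sigma>. orientation_sign (snd \<sigma>) k *
    (f (upper_face N \<sigma> k) - f (lower_face \<sigma> k)))"
proof -
  have "(\<Sum>\<tau>\<in>X. incidence N \<sigma> \<tau> * f \<tau>) = (\<Sum>k\<in>snd \<sigma>. \<Sum>\<tau>\<in>X. orientation_sign (snd \<sigma>) k *
     (of_bool (\<tau> = upper_face N \<sigma> k) - of_bool (\<tau> = lower_face \<sigma> k)) * f \<tau>)"
    unfolding incidence_alt sum_distrib_right by (rule sum.swap)
  also have "\<dots> = (\<Sum>k\<in>snd \<sigma>. orientation_sign (snd \<sigma>) k *
    (f (upper_face N \<sigma> k) - f (lower_face \<sigma> k)))"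
  proof (rule sum.cong[OF refl])
    fix k assume "k \<in> snd \<sigma>"
    have "(\<Sum>\<tau>\<in>X. orientation_sign (snd \<sigma>) k *
        (of_bool (\<tau> = upper_face N \<sigma> k) - of_bool (\<tau> = lower_face \<sigma> k)) * f \<tau>)
      = orientation_sign (snd \<sigma>) k * ((\<Sum>\<tau>\<in>X. of_bool (\<tau> = upper_face N \<sigma> k) * f \<tau>)
        - (\<Sum>\<tau>\<in>X. of_bool (\<tau> = lower_face \<sigma> k) * f \<tau>))"
      by (simp add: sum_distrib_left left_diff_distrib right_diff_distrib mult.assoc flip: sum_subtractf)
    also have "(\<Sum>\<tau>\<in>X. of_bool (\<tau> = upper_face N \<sigma> k) * f \<tau>) = f (upper_face N \<sigma> k)"
      using assms(1) assms(3)[OF \<open>k \<in> snd \<sigma>\<close>] by (simp add: of_bool_def if_distrib[of "\<lambda>x. x * _"] cong: if_cong)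
    also have "(\<Sum>\<tau>\<in>X. of_bool (\<tau> = lower_face \<sigma> k) * f \<tau>) = f (lower_face \<sigma> k)"
      using assms(1) assms(4)[OF \<open>k \<in> snd \<sigma>\<close>] by (simp add: of_bool_def if_distrib[of "\<lambda>x. x * _"] cong: if_cong)
    finally show "(\<Sum>\<tau>\<in>X. orientation_sign (snd \<sigma>) k *
        (of_bool (\<tau> = upper_face N \<sigma> k) - of_bool (\<tau> = lower_face \<sigma> k)) * f \<tau>)
      = orientation_sign (snd \<sigma>) k * (f (upper_face N \<sigma> k) - f (lower_face \<sigma> k))" .
  qed
  finally show ?thesis .
qed

text \<open>This is \<open>\<partial>\<partial> = 0\<close> on a single cell: passing to a face in direction \<open>k\<close> and then in direction
  \<open>l\<close> gives the same cells in both orders, with opposite signs.\<close>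
lemma incidence_incidence:
  fixes \<rho> :: cell
  assumes "finite X" "finite (snd \<sigma>)"
    "\<And>k. k \<in> snd \<sigma> \<Longrightarrow> upper_face N \<sigma> k \<in> X" "\<And>k. k \<in> snd \<sigma> \<Longrightarrow> lower_face \<sigma> k \<in> X"
  shows "(\<Sum>\<tau>\<in>X. incidence N \<sigma> \<tau> * incidence N \<tau> \<rho>) = (0 :: 'f::field)"
proof -
  let ?S = "snd \<sigma>"
  define e :: "nat \<Rightarrow> nat \<Rightarrow> 'f" where
    "e k l = of_bool (\<rho> = upper_face N (upper_face N \<sigma> k) l) - of_bool (\<rho> = lower_face (upper_face N \<sigma> k) l)
       - of_bool (\<rho> = upper_face N (lower_face \<sigma> k) l) + of_bool (\<rho> = lower_face (lower_face \<sigma> k) l)" for k l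
  \<comment> \<open>\<open>e k l\<close> collects the four codimension-2 faces in directions \<open>k\<close> and \<open>l\<close>; it is symmetric.\<close>
  define g :: "nat \<Rightarrow> nat \<Rightarrow> 'f" where
    "g k l = orientation_sign ?S k * orientation_sign (?S - {k}) l * e k l" for k l
  have snd: "snd (upper_face N \<sigma> k) = ?S - {k}" "snd (lower_face \<sigma> k) = ?S - {k}" for k
    by (simp_all add: upper_face_def lower_face_def)
  have "(\<Sum>\<tau>\<in>X. incidence N \<sigma> \<tau> * incidence N \<tau> \<rho>)
      = (\<Sum>k\<in>?S. orientation_sign ?S k * (incidence N (upper_face N \<sigma> k) \<rho> - incidence N (lower_face \<sigma> k) \<rho>))"
    by (rule sum_incidence[OF assms])
  also have "\<dots> = (\<Sum>k\<in>?S. \<Sum>l\<in>?S - {k}. g k l)"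
  proof (rule sum.cong[OF refl])
    fix k
    have "incidence N (upper_face N \<sigma> k) \<rho> - incidence N (lower_face \<sigma> k) \<rho>
        = (\<Sum>l\<in>?S - {k}. orientation_sign (?S - {k}) l * e k l)"
      unfolding incidence_alt snd sum_subtractf[symmetric] right_diff_distrib[symmetric]
      by (simp add: e_def diff_diff_eq2 diff_add_eq)
    then show "orientation_sign ?S k * (incidence N (upper_face N \<sigma> k) \<rho> - incidence N (lower_face \<sigma> k) \<rho>)
        = (\<Sum>l\<in>?S - {k}. g k l)"
      by (simp add: g_def sum_distrib_left mult.assoc)
  qed
  also have "\<dots> = 0"
  proof (rule sum_antisym_eq_0[OF assms(2)])
    fix k l assume kl: "k \<in> ?S" "l \<in> ?S" "k \<noteq> l"
    have "e k l = e l k"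
      using face_commute[OF kl(3)] face_commute[OF kl(3)[symmetric]] by (simp add: e_def)
    then show "g k l = - g l k"
      using orientation_sign_swap[OF assms(2) kl, where ?'f = 'f] by (simp add: g_def)
  qed
  finally show ?thesis .
qed

lemma boundary_supported:
  fixes c :: "cell \<Rightarrow> 'f::field"
  assumes "finite Y" "c \<in> supported_on Y"
  shows "boundary N c \<tau> = (\<Sum>\<sigma>\<in>Y. incidence N \<sigma> \<tau> * c \<sigma>)"
proof -
  have "boundary N c \<tau> = (\<Sum>\<sigma>\<in>Y. c \<sigma> * incidence N \<sigma> \<tau>)"
    unfolding boundary_def
    by (rule sum.mono_neutral_left) (use assms in \<open>auto simp: supported_on_def\<close>)
  then show ?thesis by (simp add: mult.commute)
qed

lemma incidence_nonzeroD:
  "incidence N \<sigma> \<tau> \<noteq> (0 :: 'f::field) \<Longrightarrow> \<exists>k\<in>snd \<sigma>. \<tau> = upper_face N \<sigma> k \<or> \<tau> = lower_face \<sigma> k"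
  unfolding incidence_def by (rule ccontr) (auto intro!: sum.neutral)

text \<open>If \<open>X\<close> contains all facets of the cells in \<open>Y\<close>, then the boundary map on chains of \<open>Y\<close> is
  the matrix of incidence numbers with rows \<open>X\<close> and columns \<open>Y\<close>.\<close>
definition faces_in :: "nat \<Rightarrow> cell set \<Rightarrow> cell set \<Rightarrow> bool" where
  "faces_in N Y X \<longleftrightarrow> (\<forall>\<sigma>\<in>Y. \<forall>k\<in>snd \<sigma>. upper_face N \<sigma> k \<in> X \<and> lower_face \<sigma> k \<in> X)"

lemma incidence_eq_0:
  assumes "faces_in N Y X" "\<sigma> \<in> Y" "\<tau> \<notin> X"
  shows "incidence N \<sigma> \<tau> = (0 :: 'f::field)"
  using incidence_nonzeroD[of N \<sigma> \<tau>, where ?'f = 'f] assms unfolding faces_in_def by blast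

lemma boundary_eq_mat_map:
  assumes "finite Y" "faces_in N Y X" "c \<in> supported_on Y"
  shows "boundary N c = mat_map (\<lambda>\<tau> \<sigma>. incidence N \<sigma> \<tau>) X Y c"
  using incidence_eq_0[OF assms(2)]
  by (auto simp: fun_eq_iff boundary_supported[OF assms(1,3)] mat_map_def intro!: sum.neutral)

lemma boundary_image_eq_mat_map:
  assumes "finite Y" "faces_in N Y X"
  shows "boundary N ` supported_on Y = mat_map (\<lambda>\<tau> \<sigma>. incidence N \<sigma> \<tau>) X Y ` supported_on Y"
  using boundary_eq_mat_map[OF assms] by (rule image_cong[OF refl])

lemma linear_on_boundary:
  assumes "finite Y"
  shows "linear_on (supported_on Y) (boundary N :: (cell \<Rightarrow> 'f::field) \<Rightarrow> cell \<Rightarrow> 'f)"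
proof -
  have "boundary N c = mat_map (\<lambda>\<tau> \<sigma>. incidence N \<sigma> \<tau>) UNIV Y c" if "c \<in> supported_on Y" for c :: "cell \<Rightarrow> 'f"
    by (rule boundary_eq_mat_map[OF assms _ that]) (simp add: faces_in_def)
  then show ?thesis
    using linear_on_mat_map[of "supported_on Y" "\<lambda>\<tau> \<sigma>. incidence N \<sigma> \<tau> :: 'f" UNIV Y]
      lin_closed_add[OF lin_closed_supported_on[of Y], where ?'b = 'f]
      lin_closed_smult[OF lin_closed_supported_on[of Y], where ?'b = 'f]
    by (simp add: linear_on_def)
qed

lemma boundary_boundary:
  fixes c :: "cell \<Rightarrow> 'f::field"
  assumes "finite Y" "\<And>\<sigma>. \<sigma> \<in> Y \<Longrightarrow> finite (snd \<sigma>)" "finite X" "faces_in N Y X" "c \<in> supported_on Y"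
  shows "boundary N (boundary N c) = (\<lambda>_. 0)"
proof
  fix \<rho>
  have supp: "boundary N c \<in> supported_on X"
    unfolding boundary_eq_mat_map[OF assms(1,4,5)] using mat_map_image_supported by blast
  have "boundary N (boundary N c) \<rho> = (\<Sum>\<tau>\<in>X. \<Sum>\<sigma>\<in>Y. incidence N \<tau> \<rho> * (incidence N \<sigma> \<tau> * c \<sigma>))"
    by (simp add: boundary_supported[OF assms(3) supp] boundary_supported[OF assms(1,5)] sum_distrib_left)
  also have "\<dots> = (\<Sum>\<sigma>\<in>Y. c \<sigma> * (\<Sum>\<tau>\<in>X. incidence N \<sigma> \<tau> * incidence N \<tau> \<rho>))"
    by (subst sum.swap) (simp add: sum_distrib_left algebra_simps)
  also have "\<dots> = 0"
    using assms(4) by (intro sum.neutral ballI) (simp add: incidence_incidence[OF assms(3) assms(2)] faces_in_def)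
  finally show "boundary N (boundary N c) \<rho> = 0" .
qed

section \<open>Homological ranks of subcomplexes of the torus\<close>

definition cells_of_dim :: "cell set \<Rightarrow> nat \<Rightarrow> cell set" where
  "cells_of_dim P j = {\<sigma> \<in> P. cell_dim \<sigma> = j}"

lemma chain_module_eq: "chain_module P j = fun_space (supported_on (cells_of_dim P j))"
  by (auto simp: chain_module_def fun_space_def supported_on_def cells_of_dim_def)

lemma cycles_eq: "cycles N P j = {c \<in> supported_on (cells_of_dim P j). boundary N c = (\<lambda>_. 0)}"
  by (simp add: cycles_def chain_module_eq)

lemma boundaries_eq: "boundaries N P j = boundary N ` supported_on (cells_of_dim P (Suc j))"
  by (simp add: boundaries_def chain_module_eq)

lemma homology_eq: "homology N P j = FactModule (fun_space (cycles N P j)) (boundaries N P j)"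
  by (simp add: homology_def chain_module_eq)

lemma cell_dim_face:
  assumes "finite (snd \<sigma>)" "k \<in> snd \<sigma>"
  shows "Suc (cell_dim (lower_face \<sigma> k)) = cell_dim \<sigma>" "Suc (cell_dim (upper_face N \<sigma> k)) = cell_dim \<sigma>"
  using card_Suc_Diff1[OF assms] by (simp_all add: cell_dim_def lower_face_def upper_face_def)

lemma finite_directions: "\<sigma> \<in> torus_cells d N s \<Longrightarrow> finite (snd \<sigma>)"
  unfolding torus_cells_def mem_Times_iff by (metis Pow_iff finite_lessThan finite_subset)

lemma lower_face_in_torus_cells: "\<sigma> \<in> torus_cells d N s \<Longrightarrow> lower_face \<sigma> k \<in> torus_cells d N s"
  unfolding torus_cells_def lower_face_def mem_Times_iff by auto

lemma subcomplex_torus_cells: "0 \<le> s \<Longrightarrow> s < 1 \<Longrightarrow> subcomplex d N s (torus_cells d N s)"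
  by (simp add: subcomplex_def lower_face_in_torus_cells upper_face_in_torus_cells)

locale torus_subcomplex =
  fixes d N :: nat and s :: real and P :: "cell set"
  assumes sub: "subcomplex d N s P"
begin

lemma in_torus: "\<sigma> \<in> P \<Longrightarrow> \<sigma> \<in> torus_cells d N s"
  using sub by (auto simp: subcomplex_def)

lemma finite_cells: "finite (cells_of_dim P j)"
  using sub finite_subset[OF _ finite_torus_cells[of d N s], of "cells_of_dim P j"]
  by (auto simp: subcomplex_def cells_of_dim_def)

lemma faces_in_cells: "faces_in N (cells_of_dim P (Suc j)) (cells_of_dim P j)"
  unfolding faces_in_def
proof (intro ballI)
  fix \<sigma> k assume \<sigma>: "\<sigma> \<in> cells_of_dim P (Suc j)" "k \<in> snd \<sigma>"
  then have "\<sigma> \<in> P" "cell_dim \<sigma> = Suc j" by (simp_all add: cells_of_dim_def)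
  then show "upper_face N \<sigma> k \<in> cells_of_dim P j \<and> lower_face \<sigma> k \<in> cells_of_dim P j"
    using cell_dim_face(1)[OF finite_directions[OF in_torus] \<sigma>(2)]
      cell_dim_face(2)[OF finite_directions[OF in_torus] \<sigma>(2), of N] sub \<sigma>(2)
    by (simp add: cells_of_dim_def subcomplex_def)
qed

lemma boundary_boundary_cells:
  assumes "c \<in> supported_on (cells_of_dim P (Suc j))"
  shows "boundary N (boundary N c) = (\<lambda>_. 0)"
  by (rule boundary_boundary[OF finite_cells _ finite_cells faces_in_cells assms])
     (use finite_directions[OF in_torus] in \<open>simp add: cells_of_dim_def\<close>)

lemma boundaries_supported: "boundaries N P j \<subseteq> supported_on (cells_of_dim P j)"
  unfolding boundaries_eq boundary_image_eq_mat_map[OF finite_cells faces_in_cells]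
  by (rule mat_map_image_supported)

lemma boundaries_subset_cycles: "boundaries N P j \<subseteq> cycles N P j"
  using boundaries_supported boundary_boundary_cells unfolding cycles_eq boundaries_eq by blast

lemma fun_fin_dim_chains: "fun_fin_dim (supported_on (cells_of_dim P j))"
  by (rule fun_fin_dim_supported_on[OF finite_cells])

lemma lin_closed_cycles: "lin_closed (cycles N P j)"
  unfolding cycles_eq
  by (rule lin_closed_kernel[OF lin_closed_supported_on linear_on_boundary[OF finite_cells]])

lemma lin_closed_boundaries: "lin_closed (boundaries N P j)"
  unfolding boundaries_eq
  by (rule lin_closed_image[OF lin_closed_supported_on linear_on_boundary[OF finite_cells]])

lemma fun_fin_dim_cycles: "fun_fin_dim (cycles N P j)"
  by (rule fun_fin_dim_subspace(1)[OF fun_fin_dim_chains lin_closed_cycles]) (auto simp: cycles_eq)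

lemma dim_cycles:
  "fun_dim (boundary N ` supported_on (cells_of_dim P j) :: (cell \<Rightarrow> 'f::field) set)
     + fun_dim (cycles N P j :: (cell \<Rightarrow> 'f) set) = card (cells_of_dim P j)"
  using fun_rank_nullity[OF fun_fin_dim_chains linear_on_boundary[OF finite_cells, where ?'f = 'f], of N j]
    fun_dim_supported_on[OF finite_cells, where ?'f = 'f]
  by (simp add: cycles_eq)

lemma betti_plus_dim_boundaries:
  "betti (F :: 'f::field itself) N P j + fun_dim (boundaries N P j :: (cell \<Rightarrow> 'f) set)
     = fun_dim (cycles N P j :: (cell \<Rightarrow> 'f) set)"
proof -
  have "cycles N P j \<inter> boundaries N P j = (boundaries N P j :: (cell \<Rightarrow> 'f) set)"
    using boundaries_subset_cycles by blast
  then show ?thesis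
    using dim_coset_image[OF lin_closed_cycles lin_closed_boundaries fun_fin_dim_cycles subset_refl,
        of j j, where ?'b = 'f]
    by (simp add: betti_def homology_eq flip: FactModule_fun_space(1))
qed

text \<open>A cycle of \<open>P\<close> dies in the homology of \<open>Q\<close> iff it is a boundary of \<open>Q\<close>. The intersection is
  written with all chains of \<open>P\<close>, as boundaries are automatically cycles; in this form it can be
  compared with the dual complex.\<close>
lemma induced_rank_plus:
  assumes "torus_subcomplex d N s Q" "P \<subseteq> Q"
  shows "induced_rank (F :: 'f::field itself) N P Q j
      + fun_dim (supported_on (cells_of_dim P j) \<inter> boundaries N Q j :: (cell \<Rightarrow> 'f) set)
      = fun_dim (cycles N P j :: (cell \<Rightarrow> 'f) set)"
proof -
  interpret Q: torus_subcomplex d N s Q by fact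
  have "cells_of_dim P k \<subseteq> cells_of_dim Q k" for k using assms(2) by (auto simp: cells_of_dim_def)
  then have supp: "supported_on (cells_of_dim P k) \<subseteq> (supported_on (cells_of_dim Q k) :: (cell \<Rightarrow> 'f) set)" for k
    by (rule supported_on_mono)
  let ?cos = "\<lambda>z :: cell \<Rightarrow> 'f. boundaries N Q j +>\<^bsub>fun_space (cycles N Q j)\<^esub> z"
  have B: "boundaries N P j \<subseteq> (boundaries N Q j :: (cell \<Rightarrow> 'f) set)"
    unfolding boundaries_eq using supp by blast
  have Z: "cycles N P j \<subseteq> (cycles N Q j :: (cell \<Rightarrow> 'f) set)"
    unfolding cycles_eq using supp by blast
  have "induced_map N Q j (boundaries N P j +>\<^bsub>fun_space (cycles N P j)\<^esub> z) = ?cos z" for z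
  proof -
    have "boundaries N Q j +>\<^bsub>chain_module Q j\<^esub> z' = ?cos z"
      if "z' \<in> boundaries N P j +>\<^bsub>fun_space (cycles N P j)\<^esub> z" for z'
    proof -
      have "(\<lambda>x. z' x - z x) \<in> boundaries N Q j"
        using that B by (auto simp: mem_coset_iff[OF lin_closed_boundaries])
      then have "?cos z' = ?cos z" by (simp add: coset_eq_iff[OF Q.lin_closed_boundaries])
      then show ?thesis by (simp add: chain_module_eq coset_fun_space)
    qed
    moreover have "z \<in> boundaries N P j +>\<^bsub>fun_space (cycles N P j)\<^esub> z"
      using lin_closed_0[OF lin_closed_boundaries] by (simp add: mem_coset_iff[OF lin_closed_boundaries])
    ultimately show ?thesis unfolding induced_map_def by blast
  qed
  then have im: "induced_map N Q j ` carrier (homology N P j) = ?cos ` cycles N P j"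
    by (simp add: homology_eq FactModule_fun_space image_image)
  have int: "cycles N P j \<inter> boundaries N Q j
      = (supported_on (cells_of_dim P j) \<inter> boundaries N Q j :: (cell \<Rightarrow> 'f) set)"
    using Q.boundaries_subset_cycles[of j, where ?'a = 'f] by (auto simp: cycles_eq)
  show ?thesis
    using dim_coset_image[OF Q.lin_closed_cycles Q.lin_closed_boundaries[of j] fun_fin_dim_cycles Z]
    by (simp add: induced_rank_def im int homology_eq[of N Q])
qed

end

section \<open>Dual cells\<close>

lemma rmod_add_left: "(x rmod m + y) rmod m = (x + y) rmod m"
proof -
  have "[x rmod m + y = x + y] (rmod m)" by simp
  then show ?thesis by (simp only: rcong_def)
qed

lemma rmod_diff_left: "(x rmod m - y) rmod m = (x - y) rmod m"
  using rmod_add_left[of x m "- y"] by simp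

definition coordinates :: "nat \<Rightarrow> real \<Rightarrow> real set" where
  "coordinates N s = (\<lambda>a. s + real a) ` {..<N}"

lemma torus_cells_eq: "torus_cells d N s = ({..<d} \<rightarrow>\<^sub>E coordinates N s) \<times> Pow {..<d}"
  by (simp add: torus_cells_def coordinates_def)

lemma rmod_coordinate:
  assumes "0 \<le> s" "s < 1" "x \<in> coordinates N s"
  shows "x rmod real N = x"
proof (rule rmod_idem)
  obtain a where "a < N" "x = s + real a" using assms(3) by (auto simp: coordinates_def)
  then show "x \<in> {0..<\<bar>real N\<bar>}" using assms(1,2) by auto
qed

lemma rmod_in_coordinates:
  assumes "0 \<le> s" "s < 1" "a < N" "x = s + real a + of_int n * real N"
  shows "x rmod real N \<in> coordinates N s"
proof -
  have "x rmod real N = s + real a"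
    by (rule rmod_unique[where n = n]) (use assms in auto)
  then show ?thesis using assms(3) by (simp add: coordinates_def)
qed

lemma half_shift_in_coordinates:
  assumes "s = 0 \<or> s = 1/2" "x \<in> coordinates N s"
  shows "(x + 1/2) rmod real N \<in> coordinates N (1/2 - s)"
    and "(x - 1/2) rmod real N \<in> coordinates N (1/2 - s)"
proof -
  obtain a where a: "a < N" "x = s + real a" using assms(2) by (auto simp: coordinates_def)
  have s: "0 \<le> 1/2 - s" "1/2 - s < 1" using assms(1) by auto
  show "(x + 1/2) rmod real N \<in> coordinates N (1/2 - s)"
  proof (cases "s = 0")
    case True
    then show ?thesis using a by (intro rmod_in_coordinates[OF s, of a N _ 0]) auto
  next
    case False
    with assms(1) have [simp]: "s = 1/2" by simp
    show ?thesis
    proof (cases "Suc a < N")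
      case True
      then show ?thesis using a by (intro rmod_in_coordinates[OF s, of "Suc a" N _ 0]) auto
    next
      case False
      \<comment> \<open>The last coordinate wraps around to the first one.\<close>
      with a have "N = Suc a" by simp
      then show ?thesis using a by (intro rmod_in_coordinates[OF s, of 0 N _ 1]) auto
    qed
  qed
  show "(x - 1/2) rmod real N \<in> coordinates N (1/2 - s)"
  proof (cases "s = 0")
    case False
    with assms(1) have "s = 1/2" by simp
    then show ?thesis using a by (intro rmod_in_coordinates[OF s, of a N _ 0]) auto
  next
    case True
    show ?thesis
    proof (cases a)
      case (Suc b)
      then show ?thesis using a True by (intro rmod_in_coordinates[OF s, of b N _ 0]) auto
    next
      case 0
      then show ?thesis
        \<comment> \<open>Below the first coordinate lies the last one.\<close>
        using a True by (intro rmod_in_coordinates[OF s, of "N - 1" N _ "-1"]) (auto simp: of_nat_diff)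
    qed
  qed
qed

text \<open>The dual of a cube has the same centre and the complementary directions: its base vertex lies
  half a unit above that of the cube in the directions of the cube and half a unit below in the
  others. The formula serves both complexes, and \<open>dual_cell_involution\<close> shows that it is its own
  inverse; the shift \<open>s \<in> {0, 1/2}\<close> becomes \<open>1/2 - s\<close>.\<close>
definition dual_cell :: "nat \<Rightarrow> nat \<Rightarrow> cell \<Rightarrow> cell" where
  "dual_cell d N \<sigma> =
     (\<lambda>k\<in>{..<d}. (if k \<in> snd \<sigma> then fst \<sigma> k + 1/2 else fst \<sigma> k - 1/2) rmod real N, {..<d} - snd \<sigma>)"

lemma cell_eqI:
  assumes "\<sigma> \<in> torus_cells d N s" "\<tau> \<in> torus_cells d N s'" "snd \<sigma> = snd \<tau>"
    "\<And>k. k < d \<Longrightarrow> fst \<sigma> k = fst \<tau> k"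
  shows "\<sigma> = \<tau>"
proof (rule prod_eqI)
  show "fst \<sigma> = fst \<tau>"
    using assms unfolding torus_cells_eq mem_Times_iff by (intro PiE_ext) auto
qed fact

context
  fixes d N :: nat and s :: real
  assumes s: "s = 0 \<or> s = 1/2"
begin

lemma shift_bounds: "0 \<le> s" "s < 1" "0 \<le> 1/2 - s" "1/2 - s < 1" "1/2 - s = 0 \<or> 1/2 - s = 1/2"
  using s by auto

lemma fst_coordinate: "\<sigma> \<in> torus_cells d N s \<Longrightarrow> k < d \<Longrightarrow> fst \<sigma> k \<in> coordinates N s"
  by (auto simp: torus_cells_eq PiE_iff)

lemma snd_subset: "\<sigma> \<in> torus_cells d N s \<Longrightarrow> snd \<sigma> \<subseteq> {..<d}"
  by (auto simp: torus_cells_eq)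

lemma dual_cell_in_torus_cells:
  assumes "\<sigma> \<in> torus_cells d N s"
  shows "dual_cell d N \<sigma> \<in> torus_cells d N (1/2 - s)"
  using half_shift_in_coordinates[OF s fst_coordinate[OF assms]]
  by (auto simp: torus_cells_eq dual_cell_def)

end

context
  fixes d N :: nat and s :: real
  assumes s: "s = 0 \<or> s = 1/2"
begin

lemma dual_cell_involution:
  assumes "\<sigma> \<in> torus_cells d N s"
  shows "dual_cell d N (dual_cell d N \<sigma>) = \<sigma>"
proof (rule cell_eqI)
  show "snd (dual_cell d N (dual_cell d N \<sigma>)) = snd \<sigma>"
    using snd_subset[OF s assms] by (auto simp: dual_cell_def)
  show "fst (dual_cell d N (dual_cell d N \<sigma>)) k = fst \<sigma> k" if "k < d" for k
    using that rmod_coordinate[OF shift_bounds(1,2)[OF s] fst_coordinate[OF s assms that]]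
    by (simp add: dual_cell_def rmod_add_left rmod_diff_left)
  show "dual_cell d N (dual_cell d N \<sigma>) \<in> torus_cells d N (1/2 - (1/2 - s))"
    by (rule dual_cell_in_torus_cells[OF shift_bounds(5)[OF s] dual_cell_in_torus_cells[OF s assms]])
qed fact

lemma cell_dim_dual:
  assumes "\<sigma> \<in> torus_cells d N s"
  shows "cell_dim \<sigma> + cell_dim (dual_cell d N \<sigma>) = d"
proof -
  have "card ({..<d} - snd \<sigma>) = d - card (snd \<sigma>)"
    using snd_subset[OF s assms] by (simp add: card_Diff_subset finite_subset)
  moreover have "card (snd \<sigma>) \<le> d"
    using card_mono[OF _ snd_subset[OF s assms]] by simp
  ultimately show ?thesis by (simp add: cell_dim_def dual_cell_def)
qed

text \<open>Duality exchanges upper and lower faces and reverses inclusions.\<close>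
lemma dual_of_upper_face:
  assumes "\<sigma> \<in> torus_cells d N s" "k \<in> snd \<sigma>"
  shows "lower_face (dual_cell d N (upper_face N \<sigma> k)) k = dual_cell d N \<sigma>"
proof -
  have "k < d" using snd_subset[OF s assms(1)] assms(2) by auto
  then show ?thesis
    using assms(2) by (auto simp: lower_face_def upper_face_def dual_cell_def fun_eq_iff rmod_diff_left add.commute)
qed

lemma dual_of_lower_face:
  assumes "\<sigma> \<in> torus_cells d N s" "k \<in> snd \<sigma>"
  shows "upper_face N (dual_cell d N (lower_face \<sigma> k)) k = dual_cell d N \<sigma>"
proof -
  have "k < d" using snd_subset[OF s assms(1)] assms(2) by auto
  moreover have "((fst \<sigma> k - 1/2) rmod real N + 1) rmod real N = (fst \<sigma> k + 1/2) rmod real N"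
    by (simp only: rmod_add_left) (simp add: algebra_simps)
  ultimately show ?thesis
    using assms(2) by (auto simp: lower_face_def upper_face_def dual_cell_def fun_eq_iff)
qed

end

lemma dual_face_iff:
  assumes s: "s = 0 \<or> s = 1/2" and \<sigma>: "\<sigma> \<in> torus_cells d N s" and \<tau>: "\<tau> \<in> torus_cells d N s" and k: "k < d"
  shows "k \<notin> snd \<sigma> \<and> dual_cell d N \<tau> = upper_face N (dual_cell d N \<sigma>) k
      \<longleftrightarrow> k \<in> snd \<tau> \<and> \<sigma> = lower_face \<tau> k"
    and "k \<notin> snd \<sigma> \<and> dual_cell d N \<tau> = lower_face (dual_cell d N \<sigma>) k
      \<longleftrightarrow> k \<in> snd \<tau> \<and> \<sigma> = upper_face N \<tau> k"
proof -
  note D = dual_cell_in_torus_cells[OF s \<sigma>]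
  have kD: "k \<notin> snd \<sigma> \<longleftrightarrow> k \<in> snd (dual_cell d N \<sigma>)" "k \<in> snd \<tau> \<longleftrightarrow> k \<notin> snd (dual_cell d N \<tau>)"
    using k by (auto simp: dual_cell_def)
  note inv = dual_cell_involution[OF s \<sigma>] dual_cell_involution[OF s \<tau>]
  have not_in: "k \<notin> snd (lower_face \<rho> k)" "k \<notin> snd (upper_face N \<rho> k)" for \<rho>
    by (simp_all add: lower_face_def upper_face_def)
  show "k \<notin> snd \<sigma> \<and> dual_cell d N \<tau> = upper_face N (dual_cell d N \<sigma>) k
      \<longleftrightarrow> k \<in> snd \<tau> \<and> \<sigma> = lower_face \<tau> k"
    using dual_of_upper_face[OF shift_bounds(5)[OF s] D, of k] dual_of_lower_face[OF s \<tau>, of k]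
      inv kD not_in by metis
  show "k \<notin> snd \<sigma> \<and> dual_cell d N \<tau> = lower_face (dual_cell d N \<sigma>) k
      \<longleftrightarrow> k \<in> snd \<tau> \<and> \<sigma> = upper_face N \<tau> k"
    using dual_of_lower_face[OF shift_bounds(5)[OF s] D, of k] dual_of_upper_face[OF s \<tau>, of k]
      inv kD not_in by metis
qed

text \<open>The product of the signs of a cell and of its face in direction \<open>k\<close> is \<open>(-1)\<^sup>k\<close>, exactly the
  discrepancy between the orientation signs of \<open>k\<close> in the face relation and in its dual.\<close>
definition cell_sign :: "cell \<Rightarrow> 'f::field" where
  "cell_sign \<sigma> = (-1) ^ \<Sum>(snd \<sigma>)"

text \<open>Each of the \<open>k\<close> directions below \<open>k\<close> belongs to exactly one of \<open>T\<close> and its complement, so the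
  two orientation signs multiply to \<open>(-1)\<^sup>k\<close>.\<close>
lemma orientation_sign_complement:
  assumes "T \<subseteq> {..<d}" "k \<in> T"
  shows "orientation_sign ({..<d} - (T - {k})) k
       = ((-1) ^ \<Sum>(T - {k}) * (-1) ^ \<Sum>T * orientation_sign T k :: 'f::field)"
proof -
  have fin: "finite T" using assms(1) finite_subset by blast
  have "k < d" using assms by auto
  then have "{..<k} = {l \<in> {..<d} - (T - {k}). l < k} \<union> {l \<in> T. l < k}" by auto
  moreover have "{l \<in> {..<d} - (T - {k}). l < k} \<inter> {l \<in> T. l < k} = {}" by auto
  ultimately have "card {..<k} = card {l \<in> {..<d} - (T - {k}). l < k} + card {l \<in> T. l < k}"
    using fin by (simp add: card_Un_disjoint)
  then have k: "k = card {l \<in> {..<d} - (T - {k}). l < k} + card {l \<in> T. l < k}" by simp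
  have T: "\<Sum>T = k + \<Sum>(T - {k})" using sum.remove[OF fin assms(2), of "\<lambda>x. x"] by simp
  \<comment> \<open>Signs are their own inverses, so each of them may be moved across an equation.\<close>
  have sq: "(-1) ^ n * (-1) ^ n = (1 :: 'f)" for n :: nat
    by (simp flip: power_mult_distrib)
  have "((-1) ^ \<Sum>(T - {k}) * (-1) ^ \<Sum>T :: 'f) = (-1) ^ k * ((-1) ^ \<Sum>(T - {k}) * (-1) ^ \<Sum>(T - {k}))"
    unfolding T power_add by (rule mult.left_commute)
  also have "\<dots> = (-1) ^ k" by (simp only: sq mult_1_right)
  also have "\<dots> = orientation_sign ({..<d} - (T - {k})) k * orientation_sign T k"
    unfolding orientation_sign_def power_add[symmetric] using k by simp
  finally show ?thesis
    by (simp only: mult.assoc) (simp add: orientation_sign_def sq)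
qed

text \<open>Up to signs, the boundary matrix of the dual complex is the transposed boundary matrix. The
  global minus sign comes from the exchange of upper and lower faces.\<close>
lemma incidence_dual:
  assumes s: "s = 0 \<or> s = 1/2" and \<sigma>: "\<sigma> \<in> torus_cells d N s" and \<tau>: "\<tau> \<in> torus_cells d N s"
  shows "incidence N (dual_cell d N \<sigma>) (dual_cell d N \<tau>)
       = - (cell_sign \<sigma> * cell_sign \<tau> * incidence N \<tau> \<sigma> :: 'f::field)"
proof -
  let ?D = "dual_cell d N"
  have expand: "incidence N \<alpha> \<beta> = (\<Sum>k<d. of_bool (k \<in> snd \<alpha>) * (orientation_sign (snd \<alpha>) k *
      (of_bool (\<beta> = upper_face N \<alpha> k) - of_bool (\<beta> = lower_face \<alpha> k))) :: 'f)"
    if "snd \<alpha> \<subseteq> {..<d}" for \<alpha> \<beta>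
    unfolding incidence_alt
    by (rule sum.mono_neutral_cong_left) (use that in auto)
  have D\<sigma>: "snd (?D \<sigma>) = {..<d} - snd \<sigma>" by (simp add: dual_cell_def)
  have "of_bool (k \<in> snd (?D \<sigma>)) * (orientation_sign (snd (?D \<sigma>)) k *
      (of_bool (?D \<tau> = upper_face N (?D \<sigma>) k) - of_bool (?D \<tau> = lower_face (?D \<sigma>) k)))
     = (- (cell_sign \<sigma> * cell_sign \<tau> * (of_bool (k \<in> snd \<tau>) * (orientation_sign (snd \<tau>) k *
      (of_bool (\<sigma> = upper_face N \<tau> k) - of_bool (\<sigma> = lower_face \<tau> k))))) :: 'f)"
    if "k < d" for k
  proof -
    note iff = dual_face_iff[OF s \<sigma> \<tau> that]
    show ?thesis
    proof (cases "k \<in> snd \<tau> \<and> (\<sigma> = lower_face \<tau> k \<or> \<sigma> = upper_face N \<tau> k)")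
      case True
      then have sub: "k \<in> snd \<tau>" "snd \<sigma> = snd \<tau> - {k}"
        by (auto simp: lower_face_def upper_face_def)
      then have "orientation_sign (snd (?D \<sigma>)) k = (cell_sign \<sigma> * cell_sign \<tau> * orientation_sign (snd \<tau>) k :: 'f)"
        using orientation_sign_complement[OF snd_subset[OF s \<tau>] sub(1)] by (simp add: D\<sigma> cell_sign_def)
      moreover have "of_bool (?D \<tau> = upper_face N (?D \<sigma>) k) = (of_bool (\<sigma> = lower_face \<tau> k) :: 'f)"
        "of_bool (?D \<tau> = lower_face (?D \<sigma>) k) = (of_bool (\<sigma> = upper_face N \<tau> k) :: 'f)"
        using iff sub by auto
      moreover have "k \<in> snd (?D \<sigma>)" using sub that by (simp add: D\<sigma>)
      ultimately show ?thesis using sub(1) by (simp add: right_diff_distrib mult.assoc)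
    next
      case False
      then have "k \<in> snd (?D \<sigma>) \<Longrightarrow> ?D \<tau> \<noteq> upper_face N (?D \<sigma>) k \<and> ?D \<tau> \<noteq> lower_face (?D \<sigma>) k"
        using iff by (auto simp: D\<sigma>)
      then show ?thesis using False by auto
    qed
  qed
  then have "incidence N (?D \<sigma>) (?D \<tau>) = (\<Sum>k<d. - (cell_sign \<sigma> * cell_sign \<tau> * (of_bool (k \<in> snd \<tau>) *
      (orientation_sign (snd \<tau>) k * (of_bool (\<sigma> = upper_face N \<tau> k) - of_bool (\<sigma> = lower_face \<tau> k))))) :: 'f)"
    by (subst expand) (auto simp: D\<sigma> intro!: sum.cong)
  then show ?thesis
    by (simp only: expand[OF snd_subset[OF s \<tau>]] sum_negf sum_distrib_left)
qed

lemma dual_cell_bij_betw: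
  assumes s: "s = 0 \<or> s = 1/2" and j: "j + j' = d"
  shows "bij_betw (dual_cell d N) (cells_of_dim (torus_cells d N s) j) (cells_of_dim (torus_cells d N (1/2 - s)) j')"
proof (rule bij_betwI[where g = "dual_cell d N"])
  note s' = shift_bounds(5)[OF s]
  show "dual_cell d N \<in> cells_of_dim (torus_cells d N s) j \<rightarrow> cells_of_dim (torus_cells d N (1/2 - s)) j'"
    using dual_cell_in_torus_cells[OF s] cell_dim_dual[OF s] j by (fastforce simp: cells_of_dim_def)
  show "dual_cell d N \<in> cells_of_dim (torus_cells d N (1/2 - s)) j' \<rightarrow> cells_of_dim (torus_cells d N s) j"
    using dual_cell_in_torus_cells[OF s'] cell_dim_dual[OF s'] j by (fastforce simp: cells_of_dim_def)
qed (auto simp: cells_of_dim_def dual_cell_involution[OF s] dual_cell_involution[OF shift_bounds(5)[OF s]])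

text \<open>In each direction exactly one of two dual cells extends, over a unit interval around the
  coordinate of the other one. The coordinates of the two complexes differ by half-integers, so
  they can only meet at the midpoint of that interval.\<close>
lemma dual_point_coordinate:
  assumes N: "N \<ge> 1" and x: "x \<in> coordinates N s" and z: "z \<in> coordinates N (1/2 - s)"
    and s: "s = 0 \<or> s = 1/2" and t: "0 \<le> t" "t \<le> 1" and eq: "z = (x + t) rmod real N"
  shows "z = (x + 1/2) rmod real N"
proof -
  obtain a b where ab: "x = s + real a" "z = 1/2 - s + real b"
    using x z by (auto simp: coordinates_def)
  have z': "z rmod real N = z" by (rule rmod_coordinate[OF shift_bounds(3,4)[OF s] z])
  have "[x + t = z] (rmod real N)" using eq z' by (simp add: rcong_def)
  then obtain n where n: "z = x + t + of_int n * real N" by (auto simp: rcong_altdef)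
  \<comment> \<open>The number \<open>t - 1/2\<close> is an integer \<open>m\<close>; the correction for \<open>s = 1/2\<close> is the difference
    \<open>(1/2 - s) - s - 1/2 = -1\<close> of the offsets.\<close>
  define m where "m = int b - int a - n * int N - (if s = 0 then 0 else 1)"
  have "t = 1/2 + of_int m" using n ab s by (auto simp: m_def)
  then have "m = 0" using t by linarith
  with \<open>t = 1/2 + of_int m\<close> have "t = 1/2" by simp
  then show ?thesis using eq by (simp only:)
qed

text \<open>Two cells of complementary dimension meet iff one is the dual cell of the other. In a direction
  in which neither extends, an integer would have to equal a half-integer; hence the directions of
  the two cells cover all directions and, by dimension, are complementary.\<close>
lemma dual_plaquettes_iff:
  assumes N: "N \<ge> 1"
  shows "dual_plaquettes d N \<sigma> \<tau> \<longleftrightarrow> \<sigma> \<in> torus_cells d N 0 \<and> \<tau> = dual_cell d N \<sigma>"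
proof
  assume "dual_plaquettes d N \<sigma> \<tau>"
  then obtain y where \<sigma>: "\<sigma> \<in> torus_cells d N 0" and \<tau>: "\<tau> \<in> torus_cells d N (1/2)"
    and dim: "cell_dim \<sigma> + cell_dim \<tau> = d" and y: "y \<in> cell_points d N \<sigma>" "y \<in> cell_points d N \<tau>"
    by (auto simp: dual_plaquettes_def)
  let ?S = "snd \<sigma>" and ?T = "snd \<tau>"
  have zero: "(0::real) = 0 \<or> (0::real) = 1/2" and half: "(1/2::real) = 0 \<or> (1/2::real) = 1/2" by simp_all
  have x: "fst \<sigma> k \<in> coordinates N 0" "fst \<sigma> k rmod real N = fst \<sigma> k" if "k < d" for k
    using fst_coordinate[OF zero \<sigma> that] rmod_coordinate[of 0 "fst \<sigma> k" N] by auto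
  have z: "fst \<tau> k \<in> coordinates N (1/2)" "fst \<tau> k rmod real N = fst \<tau> k" if "k < d" for k
    using fst_coordinate[OF half \<tau> that] rmod_coordinate[of "1/2" "fst \<tau> k" N] by auto
  have y\<sigma>: "\<exists>t\<in>(if k \<in> ?S then {0..1} else {0}). y k = (fst \<sigma> k + t) rmod real N" if "k < d" for k
    using y(1) that unfolding cell_points_def mem_Collect_eq by blast
  have y\<tau>: "\<exists>t\<in>(if k \<in> ?T then {0..1} else {0}). y k = (fst \<tau> k + t) rmod real N" if "k < d" for k
    using y(2) that unfolding cell_points_def mem_Collect_eq by blast
  have S: "?S \<subseteq> {..<d}" and T: "?T \<subseteq> {..<d}" using snd_subset[OF zero \<sigma>] snd_subset[OF half \<tau>] .
  have fin: "finite ?S" "finite ?T" using S T finite_subset by blast+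
  have cover: "k \<in> ?S \<union> ?T" if k: "k < d" for k
  proof (rule ccontr)
    assume "k \<notin> ?S \<union> ?T"
    then have eq: "fst \<sigma> k = fst \<tau> k" using y\<sigma>[OF k] y\<tau>[OF k] x(2)[OF k] z(2)[OF k] by simp
    obtain a where "fst \<sigma> k = real a" using x(1)[OF k] by (auto simp: coordinates_def)
    moreover obtain b where "fst \<tau> k = 1/2 + real b" using z(1)[OF k] by (auto simp: coordinates_def)
    ultimately have "2 * a = 1 + 2 * b" using eq by linarith
    then show False by presburger
  qed
  have un: "?S \<union> ?T = {..<d}" using cover S T by auto
  have "card ?S + card ?T = d" using dim by (simp add: cell_dim_def)
  then have "card (?S \<inter> ?T) = 0"
    using card_Un_Int[OF fin] un by simp
  then have disj: "?S \<inter> ?T = {}" using fin by simp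
  have "\<tau> = dual_cell d N \<sigma>"
  proof (rule cell_eqI[OF \<tau>])
    show "dual_cell d N \<sigma> \<in> torus_cells d N (1/2 - 0)" by (rule dual_cell_in_torus_cells[OF zero \<sigma>])
    show "?T = snd (dual_cell d N \<sigma>)" using un disj by (auto simp: dual_cell_def)
    fix k assume k: "k < d"
    show "fst \<tau> k = fst (dual_cell d N \<sigma>) k"
    proof (cases "k \<in> ?S")
      case True
      then have "k \<notin> ?T" using disj by blast
      with y\<tau>[OF k] z(2)[OF k] have "y k = fst \<tau> k" by simp
      with y\<sigma>[OF k] True obtain t where "0 \<le> t" "t \<le> 1" "fst \<tau> k = (fst \<sigma> k + t) rmod real N" by auto
      from dual_point_coordinate[OF N x(1)[OF k] _ zero this] z(1)[OF k]
      show ?thesis using True k by (simp add: dual_cell_def)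
    next
      case False
      with y\<sigma>[OF k] x(2)[OF k] have yk: "y k = fst \<sigma> k" by simp
      from False cover[OF k] have "k \<in> ?T" by blast
      with y\<tau>[OF k] yk obtain t where "0 \<le> t" "t \<le> 1" "fst \<sigma> k = (fst \<tau> k + t) rmod real N" by auto
      from dual_point_coordinate[OF N z(1)[OF k] _ half this] x(1)[OF k]
      have "fst \<sigma> k = (fst \<tau> k + 1/2) rmod real N" by simp
      then have "(fst \<sigma> k - 1/2) rmod real N = fst \<tau> k" using z(2)[OF k] by (simp add: rmod_diff_left)
      then show ?thesis using False k by (simp add: dual_cell_def)
    qed
  qed
  then show "\<sigma> \<in> torus_cells d N 0 \<and> \<tau> = dual_cell d N \<sigma>" using \<sigma> by simp
next
  assume "\<sigma> \<in> torus_cells d N 0 \<and> \<tau> = dual_cell d N \<sigma>"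
  then have \<sigma>: "\<sigma> \<in> torus_cells d N 0" and \<tau>: "\<tau> = dual_cell d N \<sigma>" by simp_all
  have zero: "(0::real) = 0 \<or> (0::real) = 1/2" by simp
  have x: "fst \<sigma> k rmod real N = fst \<sigma> k" if "k < d" for k
    using fst_coordinate[OF zero \<sigma> that] rmod_coordinate[of 0 "fst \<sigma> k" N] by auto
  \<comment> \<open>The common point is the centre of \<open>\<sigma>\<close>, which is also the centre of its dual.\<close>
  define y where "y = (\<lambda>k\<in>{..<d}. (if k \<in> snd \<sigma> then fst \<sigma> k + 1/2 else fst \<sigma> k) rmod real N)"
  have y0: "y \<in> {..<d} \<rightarrow>\<^sub>E {0..<real N}"
    using N by (auto simp: y_def rmod_nonneg rmod_less)
  have "y \<in> cell_points d N \<sigma>"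
    unfolding cell_points_def
  proof (intro CollectI conjI allI impI y0)
    fix k assume "k < d"
    then show "\<exists>t\<in>(if k \<in> snd \<sigma> then {0..1} else {0}). y k = (fst \<sigma> k + t) rmod real N"
      by (cases "k \<in> snd \<sigma>") (auto simp: y_def intro!: bexI[where x = "1/2"])
  qed
  moreover have "y \<in> cell_points d N \<tau>"
    unfolding cell_points_def
  proof (intro CollectI conjI allI impI y0)
    fix k assume "k < d"
    then show "\<exists>t\<in>(if k \<in> snd \<tau> then {0..1} else {0}). y k = (fst \<tau> k + t) rmod real N"
      by (cases "k \<in> snd \<sigma>") (auto simp: y_def \<tau> dual_cell_def rmod_add_left intro!: bexI[where x = "1/2"])
  qed
  ultimately show "dual_plaquettes d N \<sigma> \<tau>"
    using \<sigma> \<tau> dual_cell_in_torus_cells[OF zero \<sigma>] cell_dim_dual[OF zero \<sigma>]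
    by (auto simp: dual_plaquettes_def)
qed

section \<open>Dual configurations\<close>

text \<open>The dual complex, described by pulling the cells of the dual torus back to \<open>T\<close>. Unlike
  \<open>dual_complex\<close>, it takes the shift \<open>s\<close> as a parameter, so it can also be applied to the dual torus
  and is then seen to be invertible.\<close>
definition dual_config :: "nat \<Rightarrow> nat \<Rightarrow> real \<Rightarrow> cell set \<Rightarrow> cell set" where
  "dual_config d N s P = {\<tau> \<in> torus_cells d N (1/2 - s). dual_cell d N \<tau> \<notin> P}"

lemma dual_complex_eq:
  assumes "N \<ge> 1"
  shows "dual_complex d N P = dual_config d N 0 P"
proof (intro equalityI subsetI)
  fix \<tau> assume "\<tau> \<in> dual_complex d N P"
  then obtain \<sigma> where "\<sigma> \<in> torus_cells d N 0" "\<tau> = dual_cell d N \<sigma>" "\<sigma> \<notin> P"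
    by (auto simp: dual_complex_def dual_plaquettes_iff[OF assms])
  then show "\<tau> \<in> dual_config d N 0 P"
    using dual_cell_in_torus_cells[of 0 \<sigma> d N] dual_cell_involution[of 0 \<sigma> d N]
    by (simp add: dual_config_def)
next
  fix \<tau> assume "\<tau> \<in> dual_config d N 0 P"
  then have \<tau>: "\<tau> \<in> torus_cells d N (1/2)" "dual_cell d N \<tau> \<notin> P" by (simp_all add: dual_config_def)
  have "dual_plaquettes d N (dual_cell d N \<tau>) \<tau>"
    using dual_cell_in_torus_cells[of "1/2" \<tau> d N] dual_cell_involution[of "1/2" \<tau> d N] \<tau>(1)
    by (simp add: dual_plaquettes_iff[OF assms])
  then show "\<tau> \<in> dual_complex d N P" using \<tau>(2) unfolding dual_complex_def by blast
qed

lemma dual_config_in_plaquette_configs: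
  assumes s: "s = 0 \<or> s = 1/2" and i: "i \<le> d" and P: "P \<in> plaquette_configs d N s i"
  shows "dual_config d N s P \<in> plaquette_configs d N (1/2 - s) (d - i)"
proof -
  let ?P' = "dual_config d N s P" and ?T' = "torus_cells d N (1/2 - s)"
  note s' = shift_bounds(5)[OF s]
  have "\<tau> \<in> ?P' \<longleftrightarrow> \<tau> \<in> ?T' \<and> (cell_dim \<tau> < d - i \<or> cell_dim \<tau> = d - i \<and> \<tau> \<in> ?P')" for \<tau>
  proof (cases "\<tau> \<in> ?T'")
    case True
    then have "dual_cell d N \<tau> \<in> torus_cells d N s" "cell_dim \<tau> + cell_dim (dual_cell d N \<tau>) = d"
      using dual_cell_in_torus_cells[OF s' True] cell_dim_dual[OF s' True] by simp_all
    moreover have "\<forall>\<sigma>\<in>P. cell_dim \<sigma> \<le> i" "\<forall>\<sigma>\<in>torus_cells d N s. cell_dim \<sigma> < i \<longrightarrow> \<sigma> \<in> P"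
      using P by (simp_all add: plaquette_configs_def)
    ultimately show ?thesis
      using True i by (cases "cell_dim \<tau>" "d - i" rule: linorder_cases) (force simp: dual_config_def)+
  qed (simp add: dual_config_def)
  then have "?P' = {\<tau> \<in> ?T'. cell_dim \<tau> < d - i} \<union> {\<tau> \<in> ?T'. cell_dim \<tau> = d - i \<and> \<tau> \<in> ?P'}"
    by blast
  also have "\<dots> \<in> plaquette_configs d N (1/2 - s) (d - i)"
    by (rule skeleton_in_plaquette_configs[OF shift_bounds(3,4)[OF s]]) auto
  finally show ?thesis .
qed

lemma dual_config_involution:
  assumes s: "s = 0 \<or> s = 1/2" and P: "P \<subseteq> torus_cells d N s"
  shows "dual_config d N (1/2 - s) (dual_config d N s P) = P"
  using P dual_cell_in_torus_cells[OF s] dual_cell_involution[OF s]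
  by (fastforce simp: dual_config_def)

lemma dual_config_bij_betw:
  assumes i: "i \<le> d"
  shows "bij_betw (dual_config d N 0) (plaquette_configs d N 0 i) (plaquette_configs d N (1/2) (d - i))"
proof (rule bij_betwI[where g = "dual_config d N (1/2)"])
  show "dual_config d N 0 \<in> plaquette_configs d N 0 i \<rightarrow> plaquette_configs d N (1/2) (d - i)"
    using dual_config_in_plaquette_configs[of 0 i d _ N] i by auto
  show "dual_config d N (1/2) \<in> plaquette_configs d N (1/2) (d - i) \<rightarrow> plaquette_configs d N 0 i"
    using dual_config_in_plaquette_configs[of "1/2" "d - i" d _ N] i by auto
  fix P assume "P \<in> plaquette_configs d N 0 i"
  then show "dual_config d N (1/2) (dual_config d N 0 P) = P"
    using dual_config_involution[of 0 P d N] by (simp add: plaquette_configs_def subcomplex_def)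
next
  fix P assume "P \<in> plaquette_configs d N (1/2) (d - i)"
  then show "dual_config d N 0 (dual_config d N (1/2) P) = P"
    using dual_config_involution[of "1/2" P d N] by (simp add: plaquette_configs_def subcomplex_def)
qed

lemma cells_of_dual_config:
  assumes s: "s = 0 \<or> s = 1/2" and i: "i \<le> d"
  shows "cells_of_dim (dual_config d N s P) (d - i)
    = dual_cell d N ` (cells_of_dim (torus_cells d N s) i - cells_of_dim P i)"
proof -
  note s' = shift_bounds(5)[OF s]
  have bij: "bij_betw (dual_cell d N) (cells_of_dim (torus_cells d N s) i)
      (cells_of_dim (torus_cells d N (1/2 - s)) (d - i))"
    using i by (intro dual_cell_bij_betw[OF s]) simp
  show ?thesis
  proof (intro equalityI subsetI)
    fix \<tau> assume "\<tau> \<in> cells_of_dim (dual_config d N s P) (d - i)"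
    then have \<tau>: "\<tau> \<in> cells_of_dim (torus_cells d N (1/2 - s)) (d - i)" "dual_cell d N \<tau> \<notin> P"
      by (auto simp: cells_of_dim_def dual_config_def)
    then obtain \<sigma> where \<sigma>: "\<sigma> \<in> cells_of_dim (torus_cells d N s) i" "\<tau> = dual_cell d N \<sigma>"
      using bij unfolding bij_betw_def by blast
    then have "dual_cell d N \<tau> = \<sigma>" using dual_cell_involution[OF s] by (simp add: cells_of_dim_def)
    with \<tau>(2) \<sigma> show "\<tau> \<in> dual_cell d N ` (cells_of_dim (torus_cells d N s) i - cells_of_dim P i)"
      by (auto simp: cells_of_dim_def)
  next
    fix \<tau> assume "\<tau> \<in> dual_cell d N ` (cells_of_dim (torus_cells d N s) i - cells_of_dim P i)"
    then obtain \<sigma> where \<sigma>: "\<sigma> \<in> cells_of_dim (torus_cells d N s) i" "\<sigma> \<notin> P" "\<tau> = dual_cell d N \<sigma>"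
      unfolding cells_of_dim_def by blast
    then have "dual_cell d N \<tau> = \<sigma>" using dual_cell_involution[OF s] by (simp add: cells_of_dim_def)
    moreover have "\<tau> \<in> cells_of_dim (torus_cells d N (1/2 - s)) (d - i)"
      using bij \<sigma> by (auto simp: bij_betw_def)
    ultimately show "\<tau> \<in> cells_of_dim (dual_config d N s P) (d - i)"
      using \<sigma> by (auto simp: cells_of_dim_def dual_config_def)
  qed
qed

section \<open>Duality of homological ranks\<close>

text \<open>The boundary map on the dual cells of \<open>B\<close> is the transpose of the boundary matrix in degree
  \<open>j + 1\<close> with rows restricted to \<open>B\<close>, so the equation \<open>complementary_rank\<close> becomes a relation
  between boundaries of \<open>T\<close> supported outside \<open>B\<close> and boundaries of the dual cells of \<open>B\<close>.\<close>
lemma rank_duality: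
  fixes d N j :: nat and s :: real
  assumes s: "s = 0 \<or> s = 1/2" and j: "j < d" and B: "B \<subseteq> cells_of_dim (torus_cells d N s) j"
  shows "fun_dim (boundaries N (torus_cells d N s) j :: (cell \<Rightarrow> 'f::field) set)
      = fun_dim (supported_on (cells_of_dim (torus_cells d N s) j - B)
          \<inter> boundaries N (torus_cells d N s) j :: (cell \<Rightarrow> 'f) set)
      + fun_dim (boundary N ` supported_on (dual_cell d N ` B) :: (cell \<Rightarrow> 'f) set)"
proof -
  let ?T = "torus_cells d N s" and ?D = "dual_cell d N"
  let ?X = "cells_of_dim ?T j" and ?Y = "cells_of_dim ?T (Suc j)"
  let ?m = "\<lambda>\<tau> \<sigma>. incidence N \<sigma> \<tau> :: 'f"
  obtain m where m: "d = Suc (j + m)" using j less_iff_Suc_add by auto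
  interpret T: torus_subcomplex d N s ?T
    by unfold_locales (rule subcomplex_torus_cells[OF shift_bounds(1,2)[OF s]])
  interpret T': torus_subcomplex d N "1/2 - s" "torus_cells d N (1/2 - s)"
    by unfold_locales (rule subcomplex_torus_cells[OF shift_bounds(3,4)[OF s]])
  have DX: "bij_betw ?D ?X (cells_of_dim (torus_cells d N (1/2 - s)) (Suc m))"
    and DY: "bij_betw ?D ?Y (cells_of_dim (torus_cells d N (1/2 - s)) m)"
    using m by (auto intro!: dual_cell_bij_betw[OF s])
  have finB: "finite B" using B T.finite_cells finite_subset by blast
  have "?D ` B \<subseteq> cells_of_dim (torus_cells d N (1/2 - s)) (Suc m)"
    using DX B by (auto simp: bij_betw_def)
  then have faces: "faces_in N (?D ` B) (?D ` ?Y)"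
    using T'.faces_in_cells[of m] DY unfolding faces_in_def bij_betw_def by blast
  have "fun_dim (boundary N ` supported_on (?D ` B) :: (cell \<Rightarrow> 'f) set)
      = fun_dim (mat_map ?m (?D ` ?Y) (?D ` B) ` supported_on (?D ` B))"
    using boundary_image_eq_mat_map[OF finite_imageI[OF finB] faces, where ?'a = 'f] by simp
  also have "\<dots> = fun_dim (mat_map (\<lambda>\<tau> \<sigma>. incidence N \<tau> \<sigma>) ?Y B ` supported_on B :: (cell \<Rightarrow> 'f) set)"
  proof (rule mat_map_reindex[where e = "\<lambda>\<tau>. - cell_sign \<tau>" and e' = cell_sign, OF T.finite_cells])
    show "inj_on ?D ?Y" "inj_on ?D B"
      using DX DY B by (auto simp: bij_betw_def intro: inj_on_subset)
    fix \<sigma> \<tau> assume "\<sigma> \<in> B" "\<tau> \<in> ?Y"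
    then have "\<sigma> \<in> ?T" "\<tau> \<in> ?T" using B by (auto simp: cells_of_dim_def)
    then show "incidence N (?D \<sigma>) (?D \<tau>) = - cell_sign \<tau> * cell_sign \<sigma> * (incidence N \<tau> \<sigma> :: 'f)"
      by (simp add: incidence_dual[OF s] mult_ac)
  qed (simp_all add: cell_sign_def)
  finally have "fun_dim (boundary N ` supported_on (?D ` B) :: (cell \<Rightarrow> 'f) set)
      = fun_dim (mat_map (\<lambda>\<tau> \<sigma>. incidence N \<tau> \<sigma>) ?Y B ` supported_on B :: (cell \<Rightarrow> 'f) set)" .
  moreover have "boundaries N ?T j = mat_map ?m ?X ?Y ` supported_on ?Y"
    unfolding boundaries_eq by (rule boundary_image_eq_mat_map[OF T.finite_cells T.faces_in_cells])
  ultimately show ?thesis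
    using complementary_rank[OF T.finite_cells T.finite_cells B, of ?m] by (simp add: Int_commute)
qed

text \<open>A configuration has the same \<open>(i - 1)\<close>-cycles as the whole torus and no cells of dimension
  \<open>i + 1\<close>, so only its \<open>i\<close>-cells matter.\<close>
lemma config_ranks:
  fixes F :: "'f::field itself"
  assumes s: "s = 0 \<or> s = 1/2" and i: "1 \<le> i" and P: "P \<in> plaquette_configs d N s i"
  shows "betti F N P (i - 1) + fun_dim (boundary N ` supported_on (cells_of_dim P i) :: (cell \<Rightarrow> 'f) set)
      = fun_dim (cycles N (torus_cells d N s) (i - 1) :: (cell \<Rightarrow> 'f) set)"
    and "induced_rank F N P (torus_cells d N s) i
      + fun_dim (supported_on (cells_of_dim P i) \<inter> boundaries N (torus_cells d N s) i :: (cell \<Rightarrow> 'f) set)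
      + fun_dim (boundary N ` supported_on (cells_of_dim P i) :: (cell \<Rightarrow> 'f) set)
      = card (cells_of_dim P i)"
proof -
  interpret P: torus_subcomplex d N s P
    using P by unfold_locales (simp add: plaquette_configs_def)
  have T: "torus_subcomplex d N s (torus_cells d N s)"
    by unfold_locales (rule subcomplex_torus_cells[OF shift_bounds(1,2)[OF s]])
  have "cells_of_dim P (i - 1) = cells_of_dim (torus_cells d N s) (i - 1)"
    using P i by (auto simp: cells_of_dim_def plaquette_configs_def subcomplex_def)
  then have "cycles N P (i - 1) = (cycles N (torus_cells d N s) (i - 1) :: (cell \<Rightarrow> 'f) set)"
    by (simp add: cycles_eq)
  then show "betti F N P (i - 1) + fun_dim (boundary N ` supported_on (cells_of_dim P i) :: (cell \<Rightarrow> 'f) set)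
      = fun_dim (cycles N (torus_cells d N s) (i - 1) :: (cell \<Rightarrow> 'f) set)"
    using P.betti_plus_dim_boundaries[of F "i - 1"] i by (simp add: boundaries_eq)
  show "induced_rank F N P (torus_cells d N s) i
      + fun_dim (supported_on (cells_of_dim P i) \<inter> boundaries N (torus_cells d N s) i :: (cell \<Rightarrow> 'f) set)
      + fun_dim (boundary N ` supported_on (cells_of_dim P i) :: (cell \<Rightarrow> 'f) set)
      = card (cells_of_dim P i)"
    using P.induced_rank_plus[OF T subsetI[OF P.in_torus], of F i] P.dim_cycles[of i, where ?'f = 'f]
    by simp
qed

text \<open>The exponents of \<open>sqrt q\<close> contributed by homology to the weights of \<open>P\<close> and of its dual differ
  by twice the number of missing \<open>i\<close>-cells, up to a constant \<open>e\<close>.\<close>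
lemma betti_duality:
  fixes F :: "'f::field itself" and d N i :: nat
  assumes i: "1 \<le> i" "i < d"
  obtains e :: int where "\<And>P. P \<in> plaquette_configs d N 0 i \<Longrightarrow>
    2 * int (betti F N (dual_config d N 0 P) (d - i - 1))
      - int (induced_rank F N (dual_config d N 0 P) (torus_cells d N (1/2)) (d - i))
      + 2 * (int (num_cells i (torus_cells d N 0)) - int (num_cells i P))
    = 2 * int (betti F N P (i - 1)) - int (induced_rank F N P (torus_cells d N 0) i) + e"
proof -
  let ?T = "torus_cells d N 0" and ?T' = "torus_cells d N (1/2)" and ?D = "dual_cell d N"
  let ?X = "cells_of_dim ?T i"
  have zero: "(0::real) = 0 \<or> (0::real) = 1/2" and half: "(1/2::real) = 0 \<or> (1/2::real) = 1/2" by simp_all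
  define z where "z = fun_dim (cycles N ?T (i - 1) :: (cell \<Rightarrow> 'f) set)"
  define z' where "z' = fun_dim (cycles N ?T' (d - i - 1) :: (cell \<Rightarrow> 'f) set)"
  define R where "R = fun_dim (boundaries N ?T i :: (cell \<Rightarrow> 'f) set)"
  define R' where "R' = fun_dim (boundaries N ?T' (d - i) :: (cell \<Rightarrow> 'f) set)"
  have "2 * int (betti F N (dual_config d N 0 P) (d - i - 1))
      - int (induced_rank F N (dual_config d N 0 P) ?T' (d - i))
      + 2 * (int (num_cells i ?T) - int (num_cells i P))
    = 2 * int (betti F N P (i - 1)) - int (induced_rank F N P ?T i)
      + (2 * int z' - 2 * int z - int R + int R' + int (card ?X))"
    if P: "P \<in> plaquette_configs d N 0 i" for P
  proof -
    let ?P' = "dual_config d N 0 P" and ?A = "cells_of_dim P i"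
    have P': "?P' \<in> plaquette_configs d N (1/2) (d - i)"
      using dual_config_in_plaquette_configs[OF zero _ P] i by simp
    have A: "?A \<subseteq> ?X" using P by (auto simp: cells_of_dim_def plaquette_configs_def subcomplex_def)
    have A': "cells_of_dim ?P' (d - i) = ?D ` (?X - ?A)"
      using cells_of_dual_config[OF zero, of i d N P] i by simp
    have bij: "bij_betw ?D ?X (cells_of_dim ?T' (d - i))"
      using dual_cell_bij_betw[OF zero, of i "d - i" d N] i by simp
    have finX: "finite ?X"
      by (rule finite_subset[OF _ finite_torus_cells]) (auto simp: cells_of_dim_def)
    define r where "r = fun_dim (boundary N ` supported_on ?A :: (cell \<Rightarrow> 'f) set)"
    define g where "g = fun_dim (supported_on ?A \<inter> boundaries N ?T i :: (cell \<Rightarrow> 'f) set)"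
    define r' where "r' = fun_dim (boundary N ` supported_on (cells_of_dim ?P' (d - i)) :: (cell \<Rightarrow> 'f) set)"
    define g' where "g' = fun_dim (supported_on (cells_of_dim ?P' (d - i)) \<inter> boundaries N ?T' (d - i) :: (cell \<Rightarrow> 'f) set)"
    have "?X - (?X - ?A) = ?A" using A by blast
    then have 1: "R = g + r'"
      using rank_duality[OF zero i(2), of "?X - ?A" N, where ?'f = 'f]
      by (simp add: R_def g_def r'_def A')
    have inv: "?D ` ?D ` ?A = ?A"
      using dual_cell_involution[OF zero] A by (force simp: image_image cells_of_dim_def)
    have compl: "cells_of_dim ?T' (d - i) - ?D ` ?A = ?D ` (?X - ?A)"
      using bij A by (auto simp: bij_betw_def inj_on_image_set_diff[OF _ Diff_subset])
    have "?D ` ?A \<subseteq> cells_of_dim ?T' (d - i)" using bij A by (auto simp: bij_betw_def)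
    then have 2: "R' = g' + r"
      using rank_duality[OF half, of "d - i" d "?D ` ?A" N, where ?'f = 'f] i
      by (simp add: R'_def g'_def r_def A' compl inv)
    have "card (?D ` (?X - ?A)) = card (?X - ?A)"
      by (rule card_image) (use bij in \<open>auto simp: bij_betw_def intro: inj_on_subset\<close>)
    also have "\<dots> = card ?X - card ?A" by (rule card_Diff_subset[OF finite_subset[OF A finX] A])
    finally have card: "int (card (cells_of_dim ?P' (d - i))) = int (card ?X) - int (card ?A)"
      using card_mono[OF finX A] A' by simp
    have num: "num_cells i ?T = card ?X" "num_cells i P = card ?A"
      by (simp_all add: num_cells_def cells_of_dim_def)
    have "1 \<le> d - i" using i by simp
    note betti = config_ranks[OF zero i(1) P, of F, folded z_def r_def g_def]
      config_ranks[OF half this P', of F, folded z'_def r'_def g'_def]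
    show ?thesis unfolding num using betti[THEN arg_cong[where f = int]] card 1 2 by simp
  qed
  then show ?thesis by (rule that)
qed

section \<open>Duality of the random-cluster weights\<close>

lemma balanced_weight_eq:
  assumes "q > 0"
  shows "balanced_weight F d N s p q i P
    = sqrt q powi (2 * int (betti F N P (i - 1)) - int (induced_rank F N P (torus_cells d N s) i))
      * p ^ num_cells i P * (1 - p) ^ (num_cells i (torus_cells d N s) - num_cells i P)"
proof -
  have "q ^ betti F N P (i - 1) = sqrt q powi (2 * int (betti F N P (i - 1)))"
    using assms by (simp add: power_int_mult)
  then show ?thesis
    using assms by (simp add: balanced_weight_def power_int_diff power_int_minus field_simps)
qed

text \<open>With \<open>D = (1 - p) q + p\<close> one has \<open>pstar = (1 - p) q / D\<close> and \<open>1 - pstar = p / D\<close>. A missing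
  \<open>i\<close>-cell of \<open>P\<close>, which is a present cell of the dual, thus contributes \<open>1 - p\<close> together with the
  factor \<open>q\<close> required by \<open>betti_duality\<close>, and every \<open>i\<close>-cell contributes \<open>1 / D\<close>.\<close>
lemma balanced_weight_duality:
  fixes F :: "'f::field itself" and p q pstar :: real
  assumes i: "1 \<le> i" "i < d" and q: "q > 0" and p: "0 \<le> p" "p \<le> 1"
    and pstar: "pstar = (1 - p) * q / ((1 - p) * q + p)"
  obtains K where "K > 0" "\<And>P. P \<in> plaquette_configs d N 0 i \<Longrightarrow>
    balanced_weight F d N (1/2) pstar q (d - i) (dual_config d N 0 P) = K * balanced_weight F d N 0 p q i P"
proof -
  let ?T = "torus_cells d N 0" and ?T' = "torus_cells d N (1/2)"
  obtain e where e: "\<And>P. P \<in> plaquette_configs d N 0 i \<Longrightarrow>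
    2 * int (betti F N (dual_config d N 0 P) (d - i - 1))
      - int (induced_rank F N (dual_config d N 0 P) ?T' (d - i))
      + 2 * (int (num_cells i ?T) - int (num_cells i P))
    = 2 * int (betti F N P (i - 1)) - int (induced_rank F N P ?T i) + e"
    using betti_duality[OF i] by blast
  define D where "D = (1 - p) * q + p"
  have D: "D > 0"
  proof (cases "p = 0")
    case False
    then have "p > 0" "(1 - p) * q \<ge> 0" using p q by simp_all
    then show ?thesis by (simp add: D_def)
  qed (use q in \<open>simp add: D_def\<close>)
  have ps: "pstar = (1 - p) * q / D" "1 - pstar = p / D"
    using D by (simp_all add: pstar D_def field_simps)
  let ?n = "num_cells i ?T"
  have zero: "(0::real) = 0 \<or> (0::real) = 1/2" by simp
  show ?thesis
  proof (rule that[of "sqrt q powi e / D ^ ?n"])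
    show "sqrt q powi e / D ^ ?n > 0" using q D by simp
    fix P assume P: "P \<in> plaquette_configs d N 0 i"
    let ?P' = "dual_config d N 0 P" and ?\<eta> = "num_cells i P"
    let ?x = "2 * int (betti F N P (i - 1)) - int (induced_rank F N P ?T i)"
    let ?y = "2 * int (betti F N ?P' (d - i - 1)) - int (induced_rank F N ?P' ?T' (d - i))"
    have bij: "bij_betw (dual_cell d N) (cells_of_dim ?T i) (cells_of_dim ?T' (d - i))"
      using dual_cell_bij_betw[OF zero, of i "d - i" d N] i by simp
    have A: "cells_of_dim P i \<subseteq> cells_of_dim ?T i"
      using P by (auto simp: cells_of_dim_def plaquette_configs_def subcomplex_def)
    have finX: "finite (cells_of_dim ?T i)"
      by (rule finite_subset[OF _ finite_torus_cells]) (auto simp: cells_of_dim_def)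
    have le: "?\<eta> \<le> ?n"
      using card_mono[OF finX A] by (simp add: num_cells_def cells_of_dim_def)
    have n': "num_cells (d - i) ?T' = ?n"
      using bij_betw_same_card[OF bij] by (simp add: num_cells_def cells_of_dim_def)
    have "card (dual_cell d N ` (cells_of_dim ?T i - cells_of_dim P i)) = card (cells_of_dim ?T i - cells_of_dim P i)"
      by (rule card_image) (use bij in \<open>auto simp: bij_betw_def intro: inj_on_subset\<close>)
    also have "\<dots> = card (cells_of_dim ?T i) - card (cells_of_dim P i)"
      by (rule card_Diff_subset[OF finite_subset[OF A finX] A])
    finally have \<eta>': "num_cells (d - i) ?P' = ?n - ?\<eta>"
      using cells_of_dual_config[OF zero, of i d N P] i by (simp add: num_cells_def cells_of_dim_def)
    have "int (?n - ?\<eta>) = int ?n - int ?\<eta>" using le by simp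
    then have exp: "?y + 2 * int (?n - ?\<eta>) = ?x + e" using e[OF P] by simp
    have q_pow: "q ^ (?n - ?\<eta>) = sqrt q powi (2 * int (?n - ?\<eta>))"
      using q by (simp add: power_int_mult)
    have "balanced_weight F d N (1/2) pstar q (d - i) ?P'
        = sqrt q powi ?y * pstar ^ (?n - ?\<eta>) * (1 - pstar) ^ ?\<eta>"
      using le by (simp add: balanced_weight_eq[OF q] n' \<eta>')
    also have "\<dots> = sqrt q powi ?y * q ^ (?n - ?\<eta>) * (1 - p) ^ (?n - ?\<eta>) * p ^ ?\<eta> / (D ^ (?n - ?\<eta>) * D ^ ?\<eta>)"
      unfolding ps(2) unfolding ps(1) by (simp add: power_divide power_mult_distrib)
    also have "D ^ (?n - ?\<eta>) * D ^ ?\<eta> = D ^ ?n" using le by (simp flip: power_add)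
    also have "sqrt q powi ?y * q ^ (?n - ?\<eta>) = sqrt q powi (?x + e)"
      unfolding q_pow exp[symmetric] by (rule power_int_add[symmetric]) (use q in simp)
    also have "\<dots> = sqrt q powi ?x * sqrt q powi e" by (rule power_int_add) (use q in simp)
    finally show "balanced_weight F d N (1/2) pstar q (d - i) ?P'
        = sqrt q powi e / D ^ ?n * balanced_weight F d N 0 p q i P"
      by (simp add: balanced_weight_eq[OF q] mult_ac)
  qed
qed

lemma distr_point_measure_bij:
  assumes h: "bij_betw h A B" and w: "\<And>x. x \<in> A \<Longrightarrow> w' (h x) = w x"
  shows "distr (point_measure A w) (count_space B) h = point_measure B w'"
proof -
  have "point_measure A w = density (count_space A) (\<lambda>x. w' (h x))"
    unfolding point_measure_def by (rule density_cong) (use w in \<open>auto intro!: AE_I2\<close>)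
  moreover have "h \<in> measurable (count_space A) (count_space B)"
    using h by (auto simp: bij_betw_def)
  ultimately have "distr (point_measure A w) (count_space B) h
      = density (distr (count_space A) (count_space B) h) w'"
    by (simp add: density_distr)
  then show ?thesis
    by (simp add: distr_bij_count_space[OF h] point_measure_def)
qed

theorem theorem18:
  fixes F :: "'f::field itself" and d N i :: nat and p q pstar :: real
  assumes "N \<ge> 1" and "1 \<le> i" and "i \<le> d - 1"
    and "q > 0" and "0 \<le> p" and "p \<le> 1"
    and "pstar = (1 - p) * q / ((1 - p) * q + p)"
  shows "distr (balanced_PRCM F d N 0 p q i)
           (count_space (plaquette_configs d N (1/2) (d - i))) (dual_complex d N)
         = balanced_PRCM F d N (1/2) pstar q (d - i)"
proof -
  let ?w = "balanced_weight F d N 0 p q i" and ?w' = "balanced_weight F d N (1/2) pstar q (d - i)"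
  have i: "1 \<le> i" "i < d" using assms(2,3) by auto
  obtain K where K: "K > 0" "\<And>P. P \<in> plaquette_configs d N 0 i \<Longrightarrow> ?w' (dual_config d N 0 P) = K * ?w P"
    using balanced_weight_duality[OF i assms(4-7)] by blast
  have bij: "bij_betw (dual_config d N 0) (plaquette_configs d N 0 i) (plaquette_configs d N (1/2) (d - i))"
    using dual_config_bij_betw i by simp
  have "balanced_Z F d N (1/2) pstar q (d - i) = (\<Sum>P\<in>plaquette_configs d N 0 i. ?w' (dual_config d N 0 P))"
    unfolding balanced_Z_def by (rule sum.reindex_bij_betw[OF bij, symmetric])
  also have "\<dots> = K * balanced_Z F d N 0 p q i"
    by (simp add: K(2) balanced_Z_def sum_distrib_left)
  finally have Z: "balanced_Z F d N (1/2) pstar q (d - i) = K * balanced_Z F d N 0 p q i" .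
  have "dual_complex d N = dual_config d N 0" using dual_complex_eq[OF assms(1)] by (rule ext)
  then show ?thesis
    unfolding balanced_PRCM_def using K(1)
    by (simp only:) (rule distr_point_measure_bij[OF bij], simp add: K(2) Z)
qed

end
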